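(* Let $a, b, p \in \mathbb{Q}$ with $p > 0$, $\sqrt{p} \notin \mathbb{Q}$ and $a + b\sqrt{p} > 0$. Let $u > v > 0$ be real numbers, and let $M$ be the polygon lying between two homothetic concentric squares with sides $u$ and $v$ (the "square with a hole"). Then: 1) If $a - b\sqrt{p} > 0$, then $M$ can be dissected into rectangles with side ratio $a + b\sqrt{p}$ if and only if $$\frac{u + v}{u - v} \in \left\{ e + f\sqrt{p} \;:\; e, f \in \mathbb{Q},\ e > 0,\ \frac{|f|}{e} \leqslant \frac{|b|}{a} \right\}.$$ 2) If $a - b\sqrt{p} < 0$, then $M$ can be dissected into rectangles with side ratio $a + b\sqrt{p}$ if and only if $$\frac{u + v}{u - v} \in \left\{ e + f\sqrt{p} \;:\; e, f \in \mathbb{Q},\ f > 0,\ \frac{|e|}{f} \leqslant \frac{|a|}{b} \right\}.$$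
   Context: The two squares have the same center and parallel sides; $M$ is the closed region consisting of the larger square with the interior of the smaller square removed. A dissection of a polygon into rectangles is a representation of it as a union of finitely many rectangles with pairwise disjoint interiors. A rectangle has side ratio $r$ if its side lengths are $s$ and $rs$ for some $s > 0$ (no matter in which order or orientation); the rectangles in a dissection into rectangles of a given side ratio may have different sizes. *)

theory Defs
  imports "HOL-Analysis.Analysis"
begin

definition orthonormal_frame :: "real^2 \<Rightarrow> real^2 \<Rightarrow> bool" where
  "orthonormal_frame d e \<longleftrightarrow> norm d = 1 \<and> norm e = 1 \<and> d \<bullet> e = 0"

text \<open>Closed rectangle with centre \<open>c\<close> and side lengths \<open>l\<close>, \<open>h\<close> along the orthonormal
  directions \<open>d\<close>, \<open>e\<close>; it need not be parallel to the coordinate axes.\<close>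

definition rectangle :: "real^2 \<Rightarrow> real^2 \<Rightarrow> real^2 \<Rightarrow> real \<Rightarrow> real \<Rightarrow> (real^2) set" where
  "rectangle c d e l h = {c + x *\<^sub>R d + y *\<^sub>R e | x y. \<bar>x\<bar> \<le> l / 2 \<and> \<bar>y\<bar> \<le> h / 2}"

text \<open>Since the frame \<open>(d, e)\<close> is arbitrary (and may be swapped to \<open>(e, d)\<close>), the side of
  length \<open>s\<close> may point in any direction.\<close>

definition rectangle_of_ratio :: "real \<Rightarrow> (real^2) set \<Rightarrow> bool" where
  "rectangle_of_ratio r R \<longleftrightarrow>
     (\<exists>c d e s. orthonormal_frame d e \<and> s > 0 \<and> R = rectangle c d e s (r * s))"

text \<open>The definition is meant for \<open>r > 0\<close>. The rectangles then have nonempty interior, so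
  a dissection can be given as a set of rectangles instead of an indexed family.\<close>

definition dissectible_into_ratio :: "(real^2) set \<Rightarrow> real \<Rightarrow> bool" where
  "dissectible_into_ratio M r \<longleftrightarrow>
     (\<exists>\<D>. finite \<D> \<and> (\<forall>R\<in>\<D>. rectangle_of_ratio r R) \<and>
          pairwise (\<lambda>R S. interior R \<inter> interior S = {}) \<D> \<and> \<Union>\<D> = M)"

definition square_with_hole :: "real^2 \<Rightarrow> real^2 \<Rightarrow> real^2 \<Rightarrow> real \<Rightarrow> real \<Rightarrow> (real^2) set" where
  "square_with_hole c d e u v = rectangle c d e u u - interior (rectangle c d e v v)"

end

theory Submission
  imports Defs
begin

text \<open>Cutting \<open>M\<close> into a pinwheel of four rectangles of ratio \<open>x = (u + v) / (u - v)\<close> reduces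
  sufficiency to rectangles. The ratios \<open>x\<close> for which these can be dissected are closed under
  addition, inversion and multiplication by positive rationals, and the inverse of
  \<open>r = a + b sqrt p\<close> is a rational multiple of its conjugate \<open>r'\<close>; the admissible \<open>x\<close> are
  the nonnegative rational combinations of \<open>r\<close> and \<open>\<plusminus>r'\<close>.

  For necessity, the tiles must be parallel to \<open>M\<close>. Every symmetric biadditive \<open>F\<close> with
  \<open>F s (r s) \<ge> 0\<close> for all \<open>s\<close> then satisfies \<open>0 \<le> F u u - F v v = F (u - v) (u + v)\<close>,
  because \<open>F\<close> behaves like an area. A functional linear over the field generated by
  \<open>sqrt p\<close> forces \<open>x\<close> into that field, and forms built from such a functional and a
  conjugate-linear one give the inequalities between the coordinates of \<open>x\<close>.\<close>

section \<open>Rectangles and their dissections\<close>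

text \<open>Bounds on the two frame coordinates replace centre and side lengths, so that membership,
  interiors and unions become linear inequalities.\<close>

definition frame_box :: "real^2 \<Rightarrow> real^2 \<Rightarrow> real \<Rightarrow> real \<Rightarrow> real \<Rightarrow> real \<Rightarrow> (real^2) set" where
  "frame_box d e x1 x2 y1 y2 = {z. x1 \<le> z \<bullet> d \<and> z \<bullet> d \<le> x2 \<and> y1 \<le> z \<bullet> e \<and> z \<bullet> e \<le> y2}"

lemma orthonormal_frame_inner:
  assumes "orthonormal_frame d e"
  shows "d \<bullet> d = 1" "e \<bullet> e = 1" "d \<bullet> e = 0" "e \<bullet> d = 0"
  using assms by (auto simp: orthonormal_frame_def norm_eq_1 inner_commute)

lemma orthonormal_frame_swap: "orthonormal_frame d e \<Longrightarrow> orthonormal_frame e d"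
  by (auto simp: orthonormal_frame_def inner_commute)

text \<open>Two orthonormal vectors span the plane by a dimension count, so the remainder
  \<open>w\<close>, being orthogonal to both, is orthogonal to itself and vanishes.\<close>

lemma orthonormal_frame_expand:
  fixes z :: "real^2"
  assumes "orthonormal_frame d e"
  shows "z = (z \<bullet> d) *\<^sub>R d + (z \<bullet> e) *\<^sub>R e"
proof -
  note fr = orthonormal_frame_inner[OF assms]
  have ne: "d \<noteq> e" "d \<noteq> 0" "e \<noteq> 0" using fr by auto
  have "pairwise orthogonal {d, e}"
    using fr by (auto simp: pairwise_def orthogonal_def)
  then have ind: "independent {d, e}"
    using ne by (intro pairwise_orthogonal_independent) auto
  have "dim (UNIV :: (real^2) set) = card {d, e}" using ne by simp
  then have sp: "span {d, e} = UNIV"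
    using card_eq_dim[of "{d, e}" UNIV] ind by auto
  define w where "w = z - (z \<bullet> d) *\<^sub>R d - (z \<bullet> e) *\<^sub>R e"
  have "w \<bullet> d = 0" "w \<bullet> e = 0"
    by (simp_all add: w_def inner_diff_left fr)
  then have "orthogonal w y" if "y \<in> {d, e}" for y
    using that by (auto simp: orthogonal_def)
  then have "orthogonal w w"
    using orthogonal_to_span[of w "{d, e}" w] sp by blast
  then have "w = 0" by (simp add: orthogonal_self)
  then show ?thesis unfolding w_def by (simp add: algebra_simps)
qed

lemma frame_box_point:
  assumes "orthonormal_frame d e"
  shows "(x *\<^sub>R d + y *\<^sub>R e) \<bullet> d = x" "(x *\<^sub>R d + y *\<^sub>R e) \<bullet> e = y"
  using orthonormal_frame_inner[OF assms] by (simp_all add: inner_add_left)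

lemma frame_box_swap: "frame_box d e x1 x2 y1 y2 = frame_box e d y1 y2 x1 x2"
  by (auto simp: frame_box_def)

lemma frame_box_uminus: "frame_box (- d) e x1 x2 y1 y2 = frame_box d e (- x2) (- x1) y1 y2"
  by (auto simp: frame_box_def)

lemma closed_frame_box: "closed (frame_box d e x1 x2 y1 y2)"
  unfolding frame_box_def
  by (intro closed_Collect_conj closed_Collect_le continuous_intros)

lemma interior_frame_box:
  assumes "orthonormal_frame d e"
  shows "interior (frame_box d e x1 x2 y1 y2)
    = {z. x1 < z \<bullet> d \<and> z \<bullet> d < x2 \<and> y1 < z \<bullet> e \<and> z \<bullet> e < y2}"
    (is "_ = ?I")
proof
  note fr = orthonormal_frame_inner[OF assms]
  show "?I \<subseteq> interior (frame_box d e x1 x2 y1 y2)"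
  proof (rule interior_maximal)
    show "?I \<subseteq> frame_box d e x1 x2 y1 y2" by (auto simp: frame_box_def)
    show "open ?I"
      by (intro open_Collect_conj open_Collect_less continuous_intros)
  qed
  show "interior (frame_box d e x1 x2 y1 y2) \<subseteq> ?I"
  proof
    fix z assume "z \<in> interior (frame_box d e x1 x2 y1 y2)"
    then obtain \<epsilon> where \<epsilon>: "\<epsilon> > 0" "ball z \<epsilon> \<subseteq> frame_box d e x1 x2 y1 y2"
      by (auto simp: mem_interior)
    have n: "norm d = 1" "norm e = 1" using assms by (auto simp: orthonormal_frame_def)
    \<comment> \<open>Moving by half the radius both ways along each axis stays in the box, which
      makes all four inequalities strict.\<close>
    have "z + k *\<^sub>R d \<in> frame_box d e x1 x2 y1 y2" "z + k *\<^sub>R e \<in> frame_box d e x1 x2 y1 y2"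
      if "\<bar>k\<bar> = \<epsilon> / 2" for k
      using that \<epsilon> n by (auto intro!: subsetD[OF \<epsilon>(2)] simp: dist_norm)
    from this[of "\<epsilon> / 2"] this[of "- \<epsilon> / 2"] show "z \<in> ?I"
      using \<epsilon>(1) by (auto simp: frame_box_def inner_add_left inner_diff_left fr)
  qed
qed

lemma rectangle_eq_frame_box:
  assumes "orthonormal_frame d e"
  shows "rectangle c d e l h
    = frame_box d e (c \<bullet> d - l / 2) (c \<bullet> d + l / 2) (c \<bullet> e - h / 2) (c \<bullet> e + h / 2)"
proof (intro equalityI subsetI)
  note fr = orthonormal_frame_inner[OF assms]
  fix z assume "z \<in> rectangle c d e l h"
  then show "z \<in> frame_box d e (c \<bullet> d - l / 2) (c \<bullet> d + l / 2) (c \<bullet> e - h / 2) (c \<bullet> e + h / 2)"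
    by (auto simp: rectangle_def frame_box_def inner_add_left fr abs_le_iff)
next
  fix z assume z: "z \<in> frame_box d e (c \<bullet> d - l / 2) (c \<bullet> d + l / 2) (c \<bullet> e - h / 2) (c \<bullet> e + h / 2)"
  have "z - c = ((z - c) \<bullet> d) *\<^sub>R d + ((z - c) \<bullet> e) *\<^sub>R e"
    by (rule orthonormal_frame_expand[OF assms])
  then have "z = c + ((z - c) \<bullet> d) *\<^sub>R d + ((z - c) \<bullet> e) *\<^sub>R e"
    by (metis add.assoc diff_add_cancel add.commute)
  moreover have "\<bar>(z - c) \<bullet> d\<bar> \<le> l / 2" "\<bar>(z - c) \<bullet> e\<bar> \<le> h / 2"
    using z unfolding frame_box_def inner_diff_left abs_le_iff mem_Collect_eq by linarith+
  ultimately show "z \<in> rectangle c d e l h"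
    unfolding rectangle_def by blast
qed

lemma frame_box_eq_rectangle:
  assumes "orthonormal_frame d e"
  shows "frame_box d e x1 x2 y1 y2
    = rectangle (((x1 + x2) / 2) *\<^sub>R d + ((y1 + y2) / 2) *\<^sub>R e) d e (x2 - x1) (y2 - y1)"
  unfolding rectangle_eq_frame_box[OF assms] frame_box_point[OF assms]
  by (simp add: field_simps)

text \<open>Interiors of tiles of \<open>A\<close> lie in \<open>A\<close>, those of tiles of
  \<open>B\<close> in \<open>interior B\<close>. Taking the interior on one side only lets
  \<open>A\<close> be a union of boxes whose own interior never has to be computed.\<close>

lemma dissectible_Un:
  assumes "dissectible_into_ratio A r" "dissectible_into_ratio B r"
    and "A \<inter> interior B = {}"
  shows "dissectible_into_ratio (A \<union> B) r"
proof -
  obtain D1 where D1: "finite D1" "\<forall>R\<in>D1. rectangle_of_ratio r R"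
    "pairwise (\<lambda>R S. interior R \<inter> interior S = {}) D1" "\<Union>D1 = A"
    using assms(1) by (auto simp: dissectible_into_ratio_def)
  obtain D2 where D2: "finite D2" "\<forall>R\<in>D2. rectangle_of_ratio r R"
    "pairwise (\<lambda>R S. interior R \<inter> interior S = {}) D2" "\<Union>D2 = B"
    using assms(2) by (auto simp: dissectible_into_ratio_def)
  have "interior R \<inter> interior S = {}" if "R \<in> D1" "S \<in> D2" for R S
  proof -
    have "interior R \<subseteq> A" "interior S \<subseteq> interior B"
      using that D1(4) D2(4) interior_subset by (blast, auto intro!: interior_mono)
    with assms(3) show ?thesis by blast
  qed
  then have "pairwise (\<lambda>R S. interior R \<inter> interior S = {}) (D1 \<union> D2)"
    using D1(3) D2(3) unfolding pairwise_def by (metis Un_iff inf_commute)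
  then show ?thesis
    unfolding dissectible_into_ratio_def using D1 D2
    by (intro exI[of _ "D1 \<union> D2"]) auto
qed

section \<open>Closure properties of the ratios of tileable rectangles\<close>

text \<open>All positions, frames and sizes are included, so that the property can be applied to any
  piece of a larger figure, also with the two directions exchanged.\<close>

definition tileable_ratio :: "real \<Rightarrow> real \<Rightarrow> bool" where
  "tileable_ratio r x \<longleftrightarrow> (\<forall>c d e s. orthonormal_frame d e \<longrightarrow> s > 0 \<longrightarrow>
     dissectible_into_ratio (rectangle c d e s (x * s)) r)"

lemma tileable_ratio_self: "tileable_ratio r r"
  unfolding tileable_ratio_def dissectible_into_ratio_def
proof (intro allI impI)
  fix c d e :: "real^2" and s :: real
  assume "orthonormal_frame d e" "s > 0"
  then show "\<exists>\<D>. finite \<D> \<and> (\<forall>R\<in>\<D>. rectangle_of_ratio r R) \<and>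
      pairwise (\<lambda>R S. interior R \<inter> interior S = {}) \<D> \<and> \<Union>\<D> = rectangle c d e s (r * s)"
    by (intro exI[of _ "{rectangle c d e s (r * s)}"]) (auto simp: rectangle_of_ratio_def)
qed

lemma rectangle_swap:
  assumes "orthonormal_frame d e"
  shows "rectangle c d e l h = rectangle c e d h l"
  unfolding rectangle_eq_frame_box[OF assms]
    rectangle_eq_frame_box[OF orthonormal_frame_swap[OF assms]] by (rule frame_box_swap)

text \<open>This is the same rectangle with its two sides exchanged, read at the scale
  \<open>s / x\<close>.\<close>

lemma tileable_ratio_inverse:
  assumes "tileable_ratio r x" "x > 0"
  shows "tileable_ratio r (1 / x)"
  unfolding tileable_ratio_def
proof (intro allI impI)
  fix c d e :: "real^2" and s :: real
  assume fr: "orthonormal_frame d e" and "s > 0"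
  then have "orthonormal_frame e d" "s / x > 0"
    using assms(2) by (auto intro: orthonormal_frame_swap)
  then have "dissectible_into_ratio (rectangle c e d (s / x) (x * (s / x))) r"
    using assms(1) unfolding tileable_ratio_def by blast
  then show "dissectible_into_ratio (rectangle c d e s (1 / x * s)) r"
    using assms(2) by (simp add: rectangle_swap[OF fr])
qed

text \<open>Two rectangles over the same base \<open>s\<close> are stacked; they meet at height
  \<open>m\<close>.\<close>

lemma tileable_ratio_add:
  assumes "tileable_ratio r x" "tileable_ratio r y" "x > 0" "y > 0"
  shows "tileable_ratio r (x + y)"
  unfolding tileable_ratio_def
proof (intro allI impI)
  fix c d e :: "real^2" and s :: real
  assume fr: "orthonormal_frame d e" and s: "s > 0"
  define m where "m = c \<bullet> e - (x + y) * s / 2 + x * s"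
  let ?l = "c \<bullet> d - s / 2" and ?r = "c \<bullet> d + s / 2"
  let ?b = "c \<bullet> e - (x + y) * s / 2" and ?t = "c \<bullet> e + (x + y) * s / 2"
  have eq: "rectangle c d e s ((x + y) * s) = frame_box d e ?l ?r ?b m \<union> frame_box d e ?l ?r m ?t"
  proof -
    have "x * s > 0" "y * s > 0" using assms(3,4) s by simp_all
    then have "?b \<le> m" "m \<le> ?t" by (auto simp: m_def field_simps)
    then show ?thesis unfolding rectangle_eq_frame_box[OF fr] by (auto simp: frame_box_def)
  qed
  have "?r - ?l = s" "m - ?b = x * s" "?t - m = y * s"
    by (auto simp: m_def field_simps)
  then have "dissectible_into_ratio (frame_box d e ?l ?r ?b m) r"
    "dissectible_into_ratio (frame_box d e ?l ?r m ?t) r"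
    using assms(1,2) fr s unfolding frame_box_eq_rectangle[OF fr] tileable_ratio_def
    by simp_all
  then show "dissectible_into_ratio (rectangle c d e s ((x + y) * s)) r"
    unfolding eq by (rule dissectible_Un) (auto simp: interior_frame_box[OF fr], simp add: frame_box_def)
qed

lemma tileable_ratio_nat_mult:
  assumes "tileable_ratio r x" "x > 0" "n > 0"
  shows "tileable_ratio r (real n * x)"
  using assms(3)
proof (induction n rule: nat_induct_non_zero)
  case 1
  then show ?case using assms(1) by simp
next
  case (Suc n)
  then have "tileable_ratio r (real n * x + x)"
    using assms by (intro tileable_ratio_add) auto
  then show ?case by (simp add: algebra_simps)
qed

lemma tileable_ratio_rat_mult:
  assumes "tileable_ratio r x" "x > 0" "q \<in> \<rat>" "q > 0"
  shows "tileable_ratio r (q * x)"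
proof -
  obtain m n :: nat where "n \<noteq> 0" "\<bar>q\<bar> = real m / real n"
    by (rule Rats_abs_nat_div_natE[OF assms(3)])
  then have q: "q = real m / real n" "n > 0" "m > 0" using assms(4) by (auto intro: Nat.gr0I)
  \<comment> \<open>Stacking \<open>n\<close> copies of the inverse ratio and inverting again
    divides \<open>x\<close> by \<open>n\<close>; stacking \<open>m\<close> copies of the result
    then gives \<open>m / n\<close> times \<open>x\<close>.\<close>
  have "tileable_ratio r (real n * (1 / x))"
    using assms q by (intro tileable_ratio_nat_mult tileable_ratio_inverse) auto
  then have "tileable_ratio r (1 / (real n * (1 / x)))"
    using assms q by (intro tileable_ratio_inverse) auto
  then have "tileable_ratio r (real m * (1 / (real n * (1 / x))))"
    using assms q by (intro tileable_ratio_nat_mult) auto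
  then show ?thesis using q by simp
qed

lemma tileable_ratio_rat_combination:
  assumes "tileable_ratio r x" "x > 0" "tileable_ratio r y" "y > 0"
    and "q1 \<in> \<rat>" "q2 \<in> \<rat>" "q1 \<ge> 0" "q2 \<ge> 0" "q1 > 0 \<or> q2 > 0"
  shows "tileable_ratio r (q1 * x + q2 * y)"
proof (cases "q1 > 0 \<and> q2 > 0")
  case True
  then show ?thesis using assms
    by (intro tileable_ratio_add tileable_ratio_rat_mult) auto
next
  case False
  then consider "q1 = 0" "q2 > 0" | "q2 = 0" "q1 > 0" using assms by linarith
  then show ?thesis using assms tileable_ratio_rat_mult by cases auto
qed

section \<open>The pinwheel dissection\<close>

lemma square_with_hole_eq:
  assumes "orthonormal_frame d e"
  shows "square_with_hole c d e u v =
    frame_box d e (c \<bullet> d - u / 2) (c \<bullet> d + u / 2) (c \<bullet> e - u / 2) (c \<bullet> e + u / 2) -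
    {z. c \<bullet> d - v / 2 < z \<bullet> d \<and> z \<bullet> d < c \<bullet> d + v / 2 \<and>
        c \<bullet> e - v / 2 < z \<bullet> e \<and> z \<bullet> e < c \<bullet> e + v / 2}"
  unfolding square_with_hole_def rectangle_eq_frame_box[OF assms] interior_frame_box[OF assms] ..

lemma dissectible_square_with_hole:
  assumes fr: "orthonormal_frame d e" and "u > v" "v > 0"
    and T: "tileable_ratio r ((u + v) / (u - v))"
  shows "dissectible_into_ratio (square_with_hole c d e u v) r"
proof -
  define X where "X = c \<bullet> d"
  define Y where "Y = c \<bullet> e"
  have T1: "dissectible_into_ratio (frame_box d e x1 x2 y1 y2) r"
    if "x2 - x1 = (u - v) / 2" "y2 - y1 = (u + v) / 2" for x1 x2 y1 y2
  proof -
    have "y2 - y1 = (u + v) / (u - v) * (x2 - x1)" "x2 - x1 > 0"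
      unfolding that using \<open>u > v\<close> by (auto simp: field_simps)
    with T fr show ?thesis
      unfolding frame_box_eq_rectangle[OF fr] tileable_ratio_def by simp
  qed
  have T2: "dissectible_into_ratio (frame_box d e x1 x2 y1 y2) r"
    if "x2 - x1 = (u + v) / 2" "y2 - y1 = (u - v) / 2" for x1 x2 y1 y2
  proof -
    have "x2 - x1 = (u + v) / (u - v) * (y2 - y1)" "y2 - y1 > 0"
      unfolding that using \<open>u > v\<close> by (auto simp: field_simps)
    with T orthonormal_frame_swap[OF fr] show ?thesis
      unfolding frame_box_swap[of d e] frame_box_eq_rectangle[OF orthonormal_frame_swap[OF fr]]
        tileable_ratio_def by simp
  qed
  \<comment> \<open>The blades are the top, right, bottom and left strips. Each starts at a corner
    of the outer square and ends level with a side of the hole, so its sides are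
    \<open>(u + v) / 2\<close> and \<open>(u - v) / 2\<close>.\<close>
  let ?A = "frame_box d e (X - u / 2) (X + v / 2) (Y + v / 2) (Y + u / 2)"
  let ?B = "frame_box d e (X + v / 2) (X + u / 2) (Y - v / 2) (Y + u / 2)"
  let ?C = "frame_box d e (X - v / 2) (X + u / 2) (Y - u / 2) (Y - v / 2)"
  let ?D = "frame_box d e (X - u / 2) (X - v / 2) (Y - u / 2) (Y + v / 2)"
  have "dissectible_into_ratio ?A r" "dissectible_into_ratio ?B r"
    "dissectible_into_ratio ?C r" "dissectible_into_ratio ?D r"
    by (auto intro: T1 T2 simp: field_simps)
  moreover have "?A \<inter> interior ?B = {}" "(?A \<union> ?B) \<inter> interior ?C = {}"
    "(?A \<union> ?B \<union> ?C) \<inter> interior ?D = {}"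
    using assms(2,3) by (auto simp: interior_frame_box[OF fr]) (auto simp: frame_box_def)
  ultimately have "dissectible_into_ratio (?A \<union> ?B \<union> ?C \<union> ?D) r"
    by (intro dissectible_Un)
  moreover have "square_with_hole c d e u v = ?A \<union> ?B \<union> ?C \<union> ?D"
    using assms(2,3) unfolding square_with_hole_eq[OF fr] frame_box_def X_def Y_def by auto
  ultimately show ?thesis by simp
qed

section \<open>Tiles are parallel to the sides of the polygon\<close>

text \<open>In the plane a unit vector orthogonal to \<open>d\<close> is a multiple of
  \<open>e\<close> whose factor has square 1; then \<open>e'\<close> is orthogonal to
  \<open>e\<close>, and the same argument applies to it.\<close>

lemma frame_parallel:
  assumes fr: "orthonormal_frame d e" and fr': "orthonormal_frame d' e'" and "d' \<bullet> d = 0"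
  shows "d' \<in> {e, - e}" "e' \<in> {d, - d}"
proof -
  note i = orthonormal_frame_inner[OF fr] and i' = orthonormal_frame_inner[OF fr']
  define k where "k = d' \<bullet> e"
  define l where "l = e' \<bullet> d"
  have d': "d' = k *\<^sub>R e"
    using orthonormal_frame_expand[OF fr, of d'] \<open>d' \<bullet> d = 0\<close> by (simp add: k_def)
  have "k * k = 1" using i'(1) i(2) by (simp add: d')
  then have k: "k = 1 \<or> k = - 1" by (simp add: square_eq_1_iff)
  have "e' \<bullet> e = 0" using i'(4) k by (auto simp: d')
  then have e': "e' = l *\<^sub>R d"
    using orthonormal_frame_expand[OF fr, of e'] by (simp add: l_def)
  have "l * l = 1" using i'(2) i(1) by (simp add: e')
  then have l: "l = 1 \<or> l = - 1" by (simp add: square_eq_1_iff)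
  show "d' \<in> {e, - e}" "e' \<in> {d, - d}" using d' e' k l by auto
qed

lemma frame_box_uminus_right: "frame_box d (- e) x1 x2 y1 y2 = frame_box d e x1 x2 (- y2) (- y1)"
  by (auto simp: frame_box_def)

text \<open>The parallel frame differs by signs and possibly an exchange of axes. Only the unordered
  pair of side lengths is recorded, which suffices for a symmetric \<open>F\<close>.\<close>

lemma frame_box_parallel:
  assumes fr: "orthonormal_frame d e" and fr': "orthonormal_frame d' e'"
    and "d' \<bullet> d = 0 \<or> d' \<bullet> e = 0"
  obtains x1 x2 y1 y2 where "frame_box d' e' a1 a2 b1 b2 = frame_box d e x1 x2 y1 y2"
    "x2 - x1 = a2 - a1 \<and> y2 - y1 = b2 - b1 \<or> x2 - x1 = b2 - b1 \<and> y2 - y1 = a2 - a1"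
  using assms(3)
proof
  assume "d' \<bullet> d = 0"
  note p = frame_parallel[OF fr fr' this]
  have "\<exists>x1 x2 y1 y2. frame_box d' e' a1 a2 b1 b2 = frame_box d e x1 x2 y1 y2 \<and>
      x2 - x1 = b2 - b1 \<and> y2 - y1 = a2 - a1"
    unfolding frame_box_swap[of d' e']
  proof (intro exI conjI)
    \<comment> \<open>Reversing a direction turns an interval from \<open>b1\<close> to
      \<open>b2\<close> into one from \<open>- b2\<close> to \<open>- b1\<close>.\<close>
    show "frame_box e' d' b1 b2 a1 a2 = frame_box d e
      (if e' = d then b1 else - b2) (if e' = d then b2 else - b1)
      (if d' = e then a1 else - a2) (if d' = e then a2 else - a1)"
      using p by (auto simp: frame_box_uminus frame_box_uminus_right)
  qed auto
  with that show thesis by blast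
next
  assume "d' \<bullet> e = 0"
  note p = frame_parallel[OF orthonormal_frame_swap[OF fr] fr' this]
  have "\<exists>x1 x2 y1 y2. frame_box d' e' a1 a2 b1 b2 = frame_box d e x1 x2 y1 y2 \<and>
      x2 - x1 = a2 - a1 \<and> y2 - y1 = b2 - b1"
  proof (intro exI conjI)
    show "frame_box d' e' a1 a2 b1 b2 = frame_box d e
      (if d' = d then a1 else - a2) (if d' = d then a2 else - a1)
      (if e' = e then b1 else - b2) (if e' = e then b2 else - b1)"
      using p by (auto simp: frame_box_uminus frame_box_uminus_right)
  qed auto
  with that show thesis by blast
qed

lemma frontier_frame_box_subset:
  assumes "orthonormal_frame d e"
  shows "frontier (frame_box d e x1 x2 y1 y2) \<subseteq> {z. z \<bullet> d \<in> {x1, x2} \<or> z \<bullet> e \<in> {y1, y2}}"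
  unfolding frontier_def closure_closed[OF closed_frame_box] interior_frame_box[OF assms]
  by (auto simp: frame_box_def)

text \<open>Along a line in a direction orthogonal to neither axis both coordinates are injective
  functions of the parameter, so each grid line is met at most once.\<close>

lemma finite_line_inter_grid:
  assumes "A \<subseteq> {z. z \<bullet> d \<in> X \<or> z \<bullet> e \<in> Y}" "finite X" "finite Y"
    and "d' \<bullet> d \<noteq> 0" "d' \<bullet> e \<noteq> 0"
  shows "finite {t. t *\<^sub>R d' + w \<in> A}"
proof -
  have "inj (\<lambda>t. t * (d' \<bullet> d) + w \<bullet> d)" "inj (\<lambda>t. t * (d' \<bullet> e) + w \<bullet> e)"
    using assms(4,5) by (auto simp: inj_def)
  then have "finite ((\<lambda>t. t * (d' \<bullet> d) + w \<bullet> d) -` X \<union> (\<lambda>t. t * (d' \<bullet> e) + w \<bullet> e) -` Y)"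
    using assms(2,3) by (intro finite_UnI finite_vimageI)
  then show ?thesis
    by (rule rev_finite_subset) (use assms(1) in \<open>auto simp: inner_add_left\<close>)
qed

text \<open>Among the tiles with the same tilted directions, consider a side of the outermost one: it
  is covered by the boundary of \<open>M\<close> and by sides of tiles with other directions, all transversal
  to it.\<close>
lemma tiles_parallel:
  assumes fr: "orthonormal_frame d e" and fin: "finite \<D>"
    and tiles: "\<And>R. R \<in> \<D> \<Longrightarrow> \<exists>d e x1 x2 y1 y2. orthonormal_frame d e \<and>
      R = frame_box d e x1 x2 y1 y2 \<and> x1 < x2 \<and> y1 < y2"
    and disj: "pairwise (\<lambda>R S. interior R \<inter> interior S = {}) \<D>"
    and fM: "frontier (\<Union>\<D>) \<subseteq> {z. z \<bullet> d \<in> X \<or> z \<bullet> e \<in> Y}" "finite X" "finite Y"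
    and fr': "orthonormal_frame d' e'" and R: "frame_box d' e' c1 c2 k1 k2 \<in> \<D>" "c1 < c2" "k1 < k2"
  shows "d' \<bullet> d = 0 \<or> d' \<bullet> e = 0"
proof (rule ccontr)
  assume tilted: "\<not> ?thesis"
  \<comment> \<open>The tiles with the tilted directions; \<open>S0\<close> will be one whose upper
    side, in direction \<open>e'\<close>, is highest.\<close>
  define \<T> where "\<T> = {S \<in> \<D>. \<exists>a1 a2 b1 b2. S = frame_box d' e' a1 a2 b1 b2 \<and> a1 < a2 \<and> b1 < b2}"
  define top where "top S = Sup ((\<lambda>z. z \<bullet> e') ` S)" for S
  have top: "top (frame_box d' e' a1 a2 b1 b2) = b2" if "a1 < a2" "b1 < b2" for a1 a2 b1 b2
    unfolding top_def
  proof (rule cSup_eq_maximum)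
    show "b2 \<in> (\<lambda>z. z \<bullet> e') ` frame_box d' e' a1 a2 b1 b2"
      using that frame_box_point[OF fr', of a1 b2]
      by (intro image_eqI[of _ _ "a1 *\<^sub>R d' + b2 *\<^sub>R e'"]) (auto simp: frame_box_def)
  qed (auto simp: frame_box_def)
  have fT: "finite \<T>" using fin by (simp add: \<T>_def)
  have "frame_box d' e' c1 c2 k1 k2 \<in> \<T>" using R unfolding \<T>_def by blast
  then have "\<T> \<noteq> {}" by blast
  with fT obtain S0 where S0: "S0 \<in> \<T>" "top S0 = Max (top ` \<T>)"
    using obtains_MAX[of \<T> top] by metis
  then obtain a1 a2 b1 b2 where box: "S0 = frame_box d' e' a1 a2 b1 b2" "a1 < a2" "b1 < b2" "S0 \<in> \<D>"
    by (auto simp: \<T>_def)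
  have below: "z \<bullet> e' \<le> b2" if T_in: "T \<in> \<T>" and z: "z \<in> T" for T z
  proof -
    obtain x1 x2 y1 y2 where T: "T = frame_box d' e' x1 x2 y1 y2" "x1 < x2" "y1 < y2"
      using T_in unfolding \<T>_def by blast
    have "top T \<le> top S0" using S0(2) fT T_in by simp
    then have "y2 \<le> b2" using top T box by simp
    then show ?thesis using z by (auto simp: T frame_box_def)
  qed
  define F where "F = frontier (\<Union>\<D>) \<union> (\<Union>S\<in>\<D> - \<T>. frontier S)"
  note pt = frame_box_point[OF fr']
  \<comment> \<open>The open upper side of \<open>S0\<close> lies in \<open>F\<close>. Near a point
    outside \<open>F\<close>, only tiles of \<T> could cover what is just above, and none of them
    reaches higher than \<open>b2\<close>.\<close>
  have inF: "t *\<^sub>R d' + b2 *\<^sub>R e' \<in> F" if t: "a1 < t" "t < a2" for t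
  proof (rule ccontr)
    assume notF: "t *\<^sub>R d' + b2 *\<^sub>R e' \<notin> F"
    define z where "z = t *\<^sub>R d' + b2 *\<^sub>R e'"
    have shift: "z + \<epsilon> *\<^sub>R e' = t *\<^sub>R d' + (b2 + \<epsilon>) *\<^sub>R e'" for \<epsilon>
      by (simp add: z_def algebra_simps)
    have e1: "norm e' = 1" using fr' by (simp add: orthonormal_frame_def)
    have near: "z + \<epsilon> *\<^sub>R e' \<in> ball z \<delta>" if "\<bar>\<epsilon>\<bar> < \<delta>" for \<epsilon> \<delta>
      using that e1 by (simp add: dist_norm)
    have zS0: "z \<in> S0"
      using t box by (auto simp: z_def frame_box_def pt)
    have "z \<notin> interior S" if S: "S \<in> \<D> - \<T>" for S
    proof
      assume "z \<in> interior S"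
      then obtain \<delta> where \<delta>: "\<delta> > 0" "ball z \<delta> \<subseteq> interior S"
        using open_contains_ball open_interior by blast
      \<comment> \<open>The point at distance \<epsilon> below \<open>z\<close> is still inside both
        \<open>S\<close> and \<open>S0\<close>, contradicting disjoint interiors.\<close>
      define \<epsilon> where "\<epsilon> = min (\<delta> / 2) ((b2 - b1) / 2)"
      have \<epsilon>: "\<epsilon> > 0" "\<epsilon> < \<delta>" "\<epsilon> < b2 - b1"
        using \<delta>(1) box(3) by (auto simp: \<epsilon>_def min_def)
      then have "z + (- \<epsilon>) *\<^sub>R e' \<in> interior S"
        using near[of "- \<epsilon>" \<delta>] \<delta>(2) by auto
      moreover have "z + (- \<epsilon>) *\<^sub>R e' \<in> interior S0"
        unfolding shift box(1) interior_frame_box[OF fr'] mem_Collect_eq pt using t \<epsilon> by simp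
      moreover have "interior S0 \<inter> interior S = {}"
      proof (rule pairwiseD[OF disj box(4)])
        show "S \<in> \<D>" "S0 \<noteq> S" using S S0(1) by blast+
      qed
      ultimately show False by blast
    qed
    then have zS: "z \<notin> S" if "S \<in> \<D> - \<T>" for S
      using notF that closure_subset[of S] by (auto simp: F_def z_def frontier_def)
    \<comment> \<open>An open set around \<open>z\<close> that is covered by the tiles but avoids
      all those outside \<T>.\<close>
    define U where "U = interior (\<Union>\<D>) - \<Union>(\<D> - \<T>)"
    have "closed S" if "S \<in> \<D>" for S
      using tiles[OF that] closed_frame_box by auto
    then have "open U"
      unfolding U_def using fin by (intro open_Diff open_interior closed_Union) auto
    moreover have "z \<in> \<Union>\<D>" using zS0 box(4) by blast
    then have "z \<in> interior (\<Union>\<D>)"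
      using notF closure_subset[of "\<Union>\<D>"] by (auto simp: F_def z_def frontier_def)
    then have "z \<in> U" using zS by (auto simp: U_def)
    ultimately obtain \<delta> where \<delta>: "\<delta> > 0" "ball z \<delta> \<subseteq> U"
      using open_contains_ball by blast
    have zU: "z + (\<delta> / 2) *\<^sub>R e' \<in> U"
      using near[of "\<delta> / 2" \<delta>] \<delta> by auto
    then have "z + (\<delta> / 2) *\<^sub>R e' \<in> \<Union>\<D>"
      using interior_subset[of "\<Union>\<D>"] by (auto simp: U_def)
    then obtain T where "T \<in> \<D>" "z + (\<delta> / 2) *\<^sub>R e' \<in> T" by blast
    moreover from this have "T \<in> \<T>" using zU by (auto simp: U_def)
    ultimately have "(z + (\<delta> / 2) *\<^sub>R e') \<bullet> e' \<le> b2" using below by blast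
    then show False using \<delta>(1) unfolding shift pt by simp
  qed
  have fin_other: "finite {t. t *\<^sub>R d' + b2 *\<^sub>R e' \<in> frontier S}" if S: "S \<in> \<D> - \<T>" for S
  proof -
    obtain d'' e'' x1 x2 y1 y2 where fr'': "orthonormal_frame d'' e''"
      and Sbox: "S = frame_box d'' e'' x1 x2 y1 y2" and lt: "x1 < x2" "y1 < y2"
      using tiles S by blast
    \<comment> \<open>A tile parallel to the tilted frame would itself be a box in that frame and
      hence belong to \<T>.\<close>
    have nz: "\<not> (d'' \<bullet> d' = 0 \<or> d'' \<bullet> e' = 0)"
    proof
      assume "d'' \<bullet> d' = 0 \<or> d'' \<bullet> e' = 0"
      from frame_box_parallel[OF fr' fr'' this, of x1 x2 y1 y2] obtain p1 p2 q1 q2 where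
        "S = frame_box d' e' p1 p2 q1 q2"
        "p2 - p1 = x2 - x1 \<and> q2 - q1 = y2 - y1 \<or> p2 - p1 = y2 - y1 \<and> q2 - q1 = x2 - x1"
        using Sbox by metis
      moreover from this(2) have "p1 < p2" "q1 < q2" using lt by linarith+
      ultimately have "S \<in> \<T>" using S by (auto simp: \<T>_def)
      with S show False by simp
    qed
    have "d' \<bullet> e'' \<noteq> 0"
      using frame_parallel(1)[OF orthonormal_frame_swap[OF fr''] fr'] nz
        orthonormal_frame_inner(3)[OF fr'] by auto
    moreover have "d' \<bullet> d'' \<noteq> 0" using nz by (simp add: inner_commute)
    ultimately show ?thesis
      using finite_line_inter_grid[OF frontier_frame_box_subset[OF fr'']] unfolding Sbox by blast
  qed
  have "finite {t. t *\<^sub>R d' + b2 *\<^sub>R e' \<in> frontier (\<Union>\<D>)}"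
    using finite_line_inter_grid[OF fM] tilted by blast
  then have "finite ({t. t *\<^sub>R d' + b2 *\<^sub>R e' \<in> frontier (\<Union>\<D>)} \<union>
      (\<Union>S\<in>\<D> - \<T>. {t. t *\<^sub>R d' + b2 *\<^sub>R e' \<in> frontier S}))"
    using fin_other fin by blast
  \<comment> \<open>The whole side is thus covered by finitely many crossing points, although it is
    a nondegenerate segment.\<close>
  then have "finite {a1<..<a2}"
    by (rule rev_finite_subset) (use inF in \<open>force simp: F_def\<close>)
  then show False using box(2) infinite_Ioo by blast
qed

section \<open>Biadditive areas\<close>

text \<open>The next grid point. At the largest point of \<open>X\<close> the minimum is over the
  empty set and the value is unspecified; the sums below give that point weight zero or leave it
  out.\<close>

definition successor :: "real set \<Rightarrow> real \<Rightarrow> real" where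
  "successor X x = Min {y \<in> X. x < y}"

text \<open>The gaps from \<open>a\<close> to \<open>b\<close> telescope; the induction removes the
  first grid point.\<close>

lemma additive_sum_successor:
  fixes \<phi> :: "real \<Rightarrow> real"
  assumes "Modules.additive \<phi>" "finite X" "a \<in> X" "b \<in> X" "a \<le> b"
  shows "(\<Sum>x | x \<in> X \<and> a \<le> x \<and> x < b. \<phi> (successor X x - x)) = \<phi> (b - a)"
  using assms(3,5)
proof (induction "card {x \<in> X. a \<le> x \<and> x < b}" arbitrary: a rule: less_induct)
  case less
  show ?case
  proof (cases "a = b")
    case True
    then have "{x \<in> X. a \<le> x \<and> x < b} = {}" by auto
    then show ?thesis using True additive.zero[OF assms(1)] by (simp only: sum.empty) simp
  next
    case False
    let ?s = "successor X a"
    have "{y \<in> X. a < y} \<noteq> {}" "finite {y \<in> X. a < y}"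
      using False less.prems assms(2,4) by auto
    then have s: "?s \<in> X" "a < ?s" and least: "\<And>y. y \<in> X \<Longrightarrow> a < y \<Longrightarrow> ?s \<le> y"
      using Min_in[of "{y \<in> X. a < y}"] by (auto simp: successor_def)
    have "?s \<le> b" using least False less.prems assms(4) by simp
    have split: "{x \<in> X. a \<le> x \<and> x < b} = insert a {x \<in> X. ?s \<le> x \<and> x < b}"
      using s least False less.prems by force
    have fin: "finite {x \<in> X. ?s \<le> x \<and> x < b}" and notin: "a \<notin> {x \<in> X. ?s \<le> x \<and> x < b}"
      using assms(2) s by auto
    have "(\<Sum>x | x \<in> X \<and> ?s \<le> x \<and> x < b. \<phi> (successor X x - x)) = \<phi> (b - ?s)"
      using fin notin s \<open>?s \<le> b\<close> by (intro less.hyps) (simp_all add: split)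
    then have "(\<Sum>x | x \<in> X \<and> a \<le> x \<and> x < b. \<phi> (successor X x - x)) = \<phi> (?s - a) + \<phi> (b - ?s)"
      unfolding split sum.insert[OF fin notin] by simp
    also have "\<dots> = \<phi> (b - a)"
      using additive.add[OF assms(1), of "?s - a" "b - ?s"] by simp
    finally show ?thesis .
  qed
qed

text \<open>Leaving out the upper and right sides makes neighbouring boxes disjoint, so that each
  grid cell, represented by its lower left corner, belongs to a box or not without
  ambiguity.\<close>

definition half_open_box :: "real \<Rightarrow> real \<Rightarrow> real \<Rightarrow> real \<Rightarrow> real \<Rightarrow> real \<Rightarrow> bool" where
  "half_open_box x1 x2 y1 y2 x y \<longleftrightarrow> x1 \<le> x \<and> x < x2 \<and> y1 \<le> y \<and> y < y2"

text \<open>Additivity in the second argument collapses each column of cells, additivity in the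
  first then collapses the row of columns.\<close>

lemma biadditive_sum_grid:
  fixes F :: "real \<Rightarrow> real \<Rightarrow> real"
  assumes "\<And>y. Modules.additive (\<lambda>x. F x y)" "\<And>x. Modules.additive (F x)" "finite X" "finite Y"
    and "{x1, x2} \<subseteq> X" "{y1, y2} \<subseteq> Y" "x1 \<le> x2" "y1 \<le> y2"
  shows "(\<Sum>x\<in>X. \<Sum>y\<in>Y. of_bool (half_open_box x1 x2 y1 y2 x y) *
    F (successor X x - x) (successor Y y - y)) = F (x2 - x1) (y2 - y1)"
proof -
  have "(\<Sum>y\<in>Y. of_bool (half_open_box x1 x2 y1 y2 x y) * F (successor X x - x) (successor Y y - y))
      = of_bool (x1 \<le> x \<and> x < x2) * F (successor X x - x) (y2 - y1)" for x
  proof -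
    have "(\<Sum>y\<in>Y. of_bool (half_open_box x1 x2 y1 y2 x y) * F (successor X x - x) (successor Y y - y))
      = of_bool (x1 \<le> x \<and> x < x2) *
        (\<Sum>y\<in>Y. if y1 \<le> y \<and> y < y2 then F (successor X x - x) (successor Y y - y) else 0)"
      unfolding sum_distrib_left by (intro sum.cong) (auto simp: half_open_box_def)
    also have "\<dots> = of_bool (x1 \<le> x \<and> x < x2) * F (successor X x - x) (y2 - y1)"
      using additive_sum_successor[OF assms(2,4), of y1 y2] assms
      by (simp add: sum.inter_filter[symmetric])
    finally show ?thesis .
  qed
  then have "(\<Sum>x\<in>X. \<Sum>y\<in>Y. of_bool (half_open_box x1 x2 y1 y2 x y) *
      F (successor X x - x) (successor Y y - y))
    = (\<Sum>x\<in>X. if x1 \<le> x \<and> x < x2 then F (successor X x - x) (y2 - y1) else 0)"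
    by (auto intro!: sum.cong)
  also have "\<dots> = F (x2 - x1) (y2 - y1)"
    using additive_sum_successor[OF assms(1,3), of x1 x2] assms
    by (simp add: sum.inter_filter[symmetric])
  finally show ?thesis .
qed

section \<open>Exact partitions into half-open boxes\<close>

lemma eventually_at_right_shift:
  fixes a x :: real
  shows "\<forall>\<^sub>F \<epsilon> in at_right 0. (a \<le> x + \<epsilon> \<longleftrightarrow> a \<le> x) \<and> (a < x + \<epsilon> \<longleftrightarrow> a \<le> x) \<and>
    (x + \<epsilon> \<le> a \<longleftrightarrow> x < a) \<and> (x + \<epsilon> < a \<longleftrightarrow> x < a)"
  unfolding eventually_at_right_field
  by (rule exI[of _ "if x = a then 1 else \<bar>x - a\<bar>"]) auto

text \<open>After the shift, closed and open membership both mean half-open membership. The closed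
  form serves for covering, the open form for disjointness.\<close>

lemma eventually_half_open_box:
  "\<forall>\<^sub>F \<epsilon> in at_right 0.
    (x1 \<le> x + \<epsilon> \<and> x + \<epsilon> \<le> x2 \<and> y1 \<le> y + \<epsilon> \<and> y + \<epsilon> \<le> y2 \<longleftrightarrow> half_open_box x1 x2 y1 y2 x y) \<and>
    (x1 < x + \<epsilon> \<and> x + \<epsilon> < x2 \<and> y1 < y + \<epsilon> \<and> y + \<epsilon> < y2 \<longleftrightarrow> half_open_box x1 x2 y1 y2 x y)"
  using eventually_at_right_shift[of x1 x] eventually_at_right_shift[of x2 x]
    eventually_at_right_shift[of y1 y] eventually_at_right_shift[of y2 y]
  by eventually_elim (auto simp: half_open_box_def)

text \<open>Shifting a point by a small positive amount in both coordinates moves it off all the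
  boundaries, so that the half-open boxes form an exact partition.\<close>
lemma half_open_partition:
  fixes x1 x2 y1 y2 :: "'a \<Rightarrow> real" and x y :: real
  assumes "finite D"
    and cover: "\<And>x y. (\<exists>R\<in>D. x1 R \<le> x \<and> x \<le> x2 R \<and> y1 R \<le> y \<and> y \<le> y2 R) \<longleftrightarrow>
      (X1 \<le> x \<and> x \<le> X2 \<and> Y1 \<le> y \<and> y \<le> Y2) \<and> \<not> (P1 < x \<and> x < P2 \<and> Q1 < y \<and> y < Q2)"
    and disj: "\<And>R S x y. R \<in> D \<Longrightarrow> S \<in> D \<Longrightarrow> x1 R < x \<and> x < x2 R \<and> y1 R < y \<and> y < y2 R \<Longrightarrow>
      x1 S < x \<and> x < x2 S \<and> y1 S < y \<and> y < y2 S \<Longrightarrow> R = S"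
    and inside: "X1 \<le> P1" "P2 \<le> X2" "Y1 \<le> Q1" "Q2 \<le> Y2"
  shows "(\<Sum>R\<in>D. of_bool (half_open_box (x1 R) (x2 R) (y1 R) (y2 R) x y)) +
      of_bool (half_open_box P1 P2 Q1 Q2 x y) = (of_bool (half_open_box X1 X2 Y1 Y2 x y) :: real)"
proof -
  let ?H = "\<lambda>R. half_open_box (x1 R) (x2 R) (y1 R) (y2 R) x y"
  have "\<forall>\<^sub>F \<epsilon> in at_right 0. \<forall>R\<in>D.
    (x1 R \<le> x + \<epsilon> \<and> x + \<epsilon> \<le> x2 R \<and> y1 R \<le> y + \<epsilon> \<and> y + \<epsilon> \<le> y2 R \<longleftrightarrow> ?H R) \<and>
    (x1 R < x + \<epsilon> \<and> x + \<epsilon> < x2 R \<and> y1 R < y + \<epsilon> \<and> y + \<epsilon> < y2 R \<longleftrightarrow> ?H R)"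
    using assms(1) eventually_half_open_box by (intro eventually_ball_finite ballI)
  then have "\<forall>\<^sub>F \<epsilon> in at_right (0 :: real). ((\<exists>R\<in>D. ?H R) \<longleftrightarrow>
      half_open_box X1 X2 Y1 Y2 x y \<and> \<not> half_open_box P1 P2 Q1 Q2 x y) \<and>
    (\<forall>R\<in>D. \<forall>S\<in>D. ?H R \<longrightarrow> ?H S \<longrightarrow> R = S)"
    using eventually_half_open_box[of X1 x X2 Y1 y Y2] eventually_half_open_box[of P1 x P2 Q1 y Q2]
  proof eventually_elim
    case (elim \<epsilon>)
    have "(\<exists>R\<in>D. ?H R) \<longleftrightarrow>
      half_open_box X1 X2 Y1 Y2 x y \<and> \<not> half_open_box P1 P2 Q1 Q2 x y"
      using elim cover[of "x + \<epsilon>" "y + \<epsilon>"] by metis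
    moreover have "\<forall>R\<in>D. \<forall>S\<in>D. ?H R \<longrightarrow> ?H S \<longrightarrow> R = S"
      using elim(1) disj by blast
    ultimately show ?case by blast
  qed
  \<comment> \<open>The property no longer mentions \<epsilon>, so holding for all small positive
    \<epsilon> it simply holds.\<close>
  then have part: "(\<exists>R\<in>D. ?H R) \<longleftrightarrow>
      half_open_box X1 X2 Y1 Y2 x y \<and> \<not> half_open_box P1 P2 Q1 Q2 x y"
    and uniq: "\<And>R S. R \<in> D \<Longrightarrow> S \<in> D \<Longrightarrow> ?H R \<Longrightarrow> ?H S \<Longrightarrow> R = S"
    using eventually_happens'[OF trivial_limit_at_right_real[of "0 :: real"]] by blast+
  have "(\<Sum>R\<in>D. of_bool (?H R)) = (of_bool (\<exists>R\<in>D. ?H R) :: real)"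
  proof (cases "\<exists>R\<in>D. ?H R")
    case True
    then obtain R where R: "R \<in> D" "?H R" by blast
    have "(\<Sum>S\<in>D. of_bool (?H S)) = (\<Sum>S\<in>D. if S = R then 1 else 0 :: real)"
      using uniq R by (intro sum.cong) auto
    then show ?thesis using R assms(1) by auto
  next
    case False
    then show ?thesis by auto
  qed
  moreover have "half_open_box X1 X2 Y1 Y2 x y" if "half_open_box P1 P2 Q1 Q2 x y"
    using that inside by (auto simp: half_open_box_def)
  ultimately show ?thesis unfolding part by auto
qed

text \<open>Everything is cut along the grid of all side lines. Each value of \<open>F\<close>
  becomes a sum over cells, and \<open>half_open_partition\<close> says that every cell is counted
  equally often on both sides.\<close>

lemma biadditive_sum_partition:
  fixes x1 x2 y1 y2 :: "'a \<Rightarrow> real" and F :: "real \<Rightarrow> real \<Rightarrow> real"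
  assumes F: "\<And>y. Modules.additive (\<lambda>x. F x y)" "\<And>x. Modules.additive (F x)"
    and "finite D"
    and "\<And>x y. (\<exists>R\<in>D. x1 R \<le> x \<and> x \<le> x2 R \<and> y1 R \<le> y \<and> y \<le> y2 R) \<longleftrightarrow>
      (X1 \<le> x \<and> x \<le> X2 \<and> Y1 \<le> y \<and> y \<le> Y2) \<and> \<not> (P1 < x \<and> x < P2 \<and> Q1 < y \<and> y < Q2)"
    and "\<And>R S x y. R \<in> D \<Longrightarrow> S \<in> D \<Longrightarrow> x1 R < x \<and> x < x2 R \<and> y1 R < y \<and> y < y2 R \<Longrightarrow>
      x1 S < x \<and> x < x2 S \<and> y1 S < y \<and> y < y2 S \<Longrightarrow> R = S"
    and "X1 \<le> P1" "P2 \<le> X2" "Y1 \<le> Q1" "Q2 \<le> Y2" "P1 \<le> P2" "Q1 \<le> Q2"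
    and le: "\<And>R. R \<in> D \<Longrightarrow> x1 R \<le> x2 R \<and> y1 R \<le> y2 R"
  shows "(\<Sum>R\<in>D. F (x2 R - x1 R) (y2 R - y1 R)) + F (P2 - P1) (Q2 - Q1) = F (X2 - X1) (Y2 - Y1)"
proof -
  have part: "(\<Sum>R\<in>D. of_bool (half_open_box (x1 R) (x2 R) (y1 R) (y2 R) x y)) +
      of_bool (half_open_box P1 P2 Q1 Q2 x y) = (of_bool (half_open_box X1 X2 Y1 Y2 x y) :: real)"
    for x y using assms(3-9) by (rule half_open_partition)
  define X where "X = x1 ` D \<union> x2 ` D \<union> {X1, X2, P1, P2}"
  define Y where "Y = y1 ` D \<union> y2 ` D \<union> {Y1, Y2, Q1, Q2}"
  have XY: "finite X" "finite Y" using assms(3) by (auto simp: X_def Y_def)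
  define G where "G x y = F (successor X x - x) (successor Y y - y)" for x y
  note grid = biadditive_sum_grid[OF F XY, folded G_def]
  have "F (x2 R - x1 R) (y2 R - y1 R)
      = (\<Sum>x\<in>X. \<Sum>y\<in>Y. of_bool (half_open_box (x1 R) (x2 R) (y1 R) (y2 R) x y) * G x y)"
    if "R \<in> D" for R
    using that le[OF that] by (intro grid[symmetric]) (auto simp: X_def Y_def)
  then have "(\<Sum>R\<in>D. F (x2 R - x1 R) (y2 R - y1 R))
      = (\<Sum>R\<in>D. \<Sum>x\<in>X. \<Sum>y\<in>Y. of_bool (half_open_box (x1 R) (x2 R) (y1 R) (y2 R) x y) * G x y)"
    by (rule sum.cong[OF refl])
  also have "\<dots> = (\<Sum>x\<in>X. \<Sum>y\<in>Y.
      (\<Sum>R\<in>D. of_bool (half_open_box (x1 R) (x2 R) (y1 R) (y2 R) x y)) * G x y)"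
    unfolding sum.swap[of _ X D] sum.swap[of _ Y D] sum_distrib_right ..
  finally have D: "(\<Sum>R\<in>D. F (x2 R - x1 R) (y2 R - y1 R)) = \<dots>" .
  have P: "F (P2 - P1) (Q2 - Q1) = (\<Sum>x\<in>X. \<Sum>y\<in>Y. of_bool (half_open_box P1 P2 Q1 Q2 x y) * G x y)"
    using assms by (intro grid[symmetric]) (auto simp: X_def Y_def)
  have "F (X2 - X1) (Y2 - Y1) = (\<Sum>x\<in>X. \<Sum>y\<in>Y. of_bool (half_open_box X1 X2 Y1 Y2 x y) * G x y)"
    using assms by (intro grid[symmetric]) (auto simp: X_def Y_def)
  then show ?thesis
    unfolding D P
    unfolding sum.distrib[symmetric] distrib_right[symmetric] part by (rule sym)
qed

section \<open>Biadditive areas of the square with a hole\<close>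

lemma frontier_square_with_hole_subset:
  assumes fr: "orthonormal_frame d e"
  shows "frontier (square_with_hole c d e u v) \<subseteq>
    {z. z \<bullet> d \<in> {c \<bullet> d - u / 2, c \<bullet> d + u / 2, c \<bullet> d - v / 2, c \<bullet> d + v / 2} \<or>
        z \<bullet> e \<in> {c \<bullet> e - u / 2, c \<bullet> e + u / 2, c \<bullet> e - v / 2, c \<bullet> e + v / 2}}"
proof -
  have "square_with_hole c d e u v = rectangle c d e u u \<inter> (- interior (rectangle c d e v v))"
    by (auto simp: square_with_hole_def)
  then have "frontier (square_with_hole c d e u v)
      \<subseteq> frontier (rectangle c d e u u) \<union> frontier (rectangle c d e v v)"
    using frontier_Int_subset[of "rectangle c d e u u" "- interior (rectangle c d e v v)"]
      frontier_interior_subset[of "rectangle c d e v v"] by (auto simp: frontier_complement)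
  also have "\<dots> \<subseteq>
    {z. z \<bullet> d \<in> {c \<bullet> d - u / 2, c \<bullet> d + u / 2, c \<bullet> d - v / 2, c \<bullet> d + v / 2} \<or>
        z \<bullet> e \<in> {c \<bullet> e - u / 2, c \<bullet> e + u / 2, c \<bullet> e - v / 2, c \<bullet> e + v / 2}}"
    using frontier_frame_box_subset[OF fr] unfolding rectangle_eq_frame_box[OF fr] by blast
  finally show ?thesis .
qed

lemma biadditive_nonneg_of_dissectible:
  fixes F :: "real \<Rightarrow> real \<Rightarrow> real"
  assumes fr: "orthonormal_frame d e" and "u > v" "v > 0" "r > 0"
    and dis: "dissectible_into_ratio (square_with_hole c d e u v) r"
    and F: "\<And>y. Modules.additive (\<lambda>x. F x y)" "\<And>x. Modules.additive (F x)"
    and sym: "\<And>x y. F x y = F y x" and pos: "\<And>s. F s (r * s) \<ge> 0"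
  shows "F (u - v) (u + v) \<ge> 0"
proof -
  let ?M = "square_with_hole c d e u v"
  obtain \<D> where D: "finite \<D>" "\<And>R. R \<in> \<D> \<Longrightarrow> rectangle_of_ratio r R"
    "pairwise (\<lambda>R S. interior R \<inter> interior S = {}) \<D>" "\<Union>\<D> = ?M"
    using dis by (auto simp: dissectible_into_ratio_def)
  have box: "\<exists>d' e' a1 a2 b1 b2. orthonormal_frame d' e' \<and> R = frame_box d' e' a1 a2 b1 b2 \<and>
      a1 < a2 \<and> b1 < b2 \<and> b2 - b1 = r * (a2 - a1)" if R: "R \<in> \<D>" for R
  proof -
    obtain c' d' e' s where "orthonormal_frame d' e'" "s > 0" "R = rectangle c' d' e' s (r * s)"
      using D(2)[OF R] by (auto simp: rectangle_of_ratio_def)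
    moreover have "r * s > 0" using \<open>r > 0\<close> \<open>s > 0\<close> by simp
    ultimately show ?thesis
      by (intro exI[of _ d'] exI[of _ e'] exI[of _ "c' \<bullet> d' - s / 2"] exI[of _ "c' \<bullet> d' + s / 2"]
        exI[of _ "c' \<bullet> e' - r * s / 2"] exI[of _ "c' \<bullet> e' + r * s / 2"])
        (simp add: rectangle_eq_frame_box)
  qed
  have "\<exists>x1 x2 y1 y2. R = frame_box d e x1 x2 y1 y2 \<and> x1 < x2 \<and> y1 < y2 \<and>
      F (x2 - x1) (y2 - y1) \<ge> 0" if R: "R \<in> \<D>" for R
  proof -
    obtain d' e' a1 a2 b1 b2 where fr': "orthonormal_frame d' e'" and
      eq: "R = frame_box d' e' a1 a2 b1 b2" and lt: "a1 < a2" "b1 < b2" "b2 - b1 = r * (a2 - a1)"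
      using box[OF R] by blast
    have "d' \<bullet> d = 0 \<or> d' \<bullet> e = 0"
    proof (rule tiles_parallel[OF fr D(1)])
      show "frontier (\<Union>\<D>) \<subseteq>
        {z. z \<bullet> d \<in> {c \<bullet> d - u / 2, c \<bullet> d + u / 2, c \<bullet> d - v / 2, c \<bullet> d + v / 2} \<or>
            z \<bullet> e \<in> {c \<bullet> e - u / 2, c \<bullet> e + u / 2, c \<bullet> e - v / 2, c \<bullet> e + v / 2}}"
        unfolding D(4) by (rule frontier_square_with_hole_subset[OF fr])
      show "\<exists>d e x1 x2 y1 y2. orthonormal_frame d e \<and> S = frame_box d e x1 x2 y1 y2 \<and>
        x1 < x2 \<and> y1 < y2" if "S \<in> \<D>" for S
        using box[OF that] by blast
      show "frame_box d' e' a1 a2 b1 b2 \<in> \<D>" using R eq by simp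
    qed (use D(3) fr' lt in auto)
    then obtain x1 x2 y1 y2 where xy: "R = frame_box d e x1 x2 y1 y2"
      "x2 - x1 = a2 - a1 \<and> y2 - y1 = b2 - b1 \<or> x2 - x1 = b2 - b1 \<and> y2 - y1 = a2 - a1"
      using frame_box_parallel[OF fr fr'] unfolding eq by metis
    \<comment> \<open>A tile may stand or lie; symmetry of \<open>F\<close> reduces both positions
      to \<open>pos\<close>.\<close>
    from xy(2) have "F (x2 - x1) (y2 - y1) \<ge> 0"
      using pos[of "a2 - a1"] lt(3) sym by auto
    moreover have "x1 < x2" "y1 < y2" using xy(2) lt by linarith+
    ultimately show ?thesis using xy(1) by blast
  qed
  then obtain x1 x2 y1 y2 where xy: "\<And>R. R \<in> \<D> \<Longrightarrow>
      R = frame_box d e (x1 R) (x2 R) (y1 R) (y2 R) \<and> x1 R < x2 R \<and> y1 R < y2 R \<and>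
      F (x2 R - x1 R) (y2 R - y1 R) \<ge> 0"
    by metis
  let ?X = "c \<bullet> d" and ?Y = "c \<bullet> e"
  have "(\<Sum>R\<in>\<D>. F (x2 R - x1 R) (y2 R - y1 R)) +
      F ((?X + v / 2) - (?X - v / 2)) ((?Y + v / 2) - (?Y - v / 2)) =
      F ((?X + u / 2) - (?X - u / 2)) ((?Y + u / 2) - (?Y - u / 2))"
  proof (rule biadditive_sum_partition[OF F D(1)])
    note pt = frame_box_point[OF fr]
    show "(\<exists>R\<in>\<D>. x1 R \<le> x \<and> x \<le> x2 R \<and> y1 R \<le> y \<and> y \<le> y2 R) \<longleftrightarrow>
      (?X - u / 2 \<le> x \<and> x \<le> ?X + u / 2 \<and> ?Y - u / 2 \<le> y \<and> y \<le> ?Y + u / 2) \<and>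
      \<not> (?X - v / 2 < x \<and> x < ?X + v / 2 \<and> ?Y - v / 2 < y \<and> y < ?Y + v / 2)" for x y
    proof -
      define z where "z = x *\<^sub>R d + y *\<^sub>R e"
      have "z \<in> R \<longleftrightarrow> x1 R \<le> x \<and> x \<le> x2 R \<and> y1 R \<le> y \<and> y \<le> y2 R" if "R \<in> \<D>" for R
      proof -
        have "z \<in> R \<longleftrightarrow> z \<in> frame_box d e (x1 R) (x2 R) (y1 R) (y2 R)" using xy[OF that] by simp
        then show ?thesis unfolding frame_box_def z_def mem_Collect_eq pt .
      qed
      then have "(\<exists>R\<in>\<D>. x1 R \<le> x \<and> x \<le> x2 R \<and> y1 R \<le> y \<and> y \<le> y2 R) \<longleftrightarrow> z \<in> \<Union>\<D>" by blast
      then show ?thesis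
        unfolding D(4) square_with_hole_eq[OF fr] frame_box_def Diff_iff mem_Collect_eq z_def pt .
    qed
    show "R = S" if "R \<in> \<D>" "S \<in> \<D>" and
      in_R: "x1 R < x \<and> x < x2 R \<and> y1 R < y \<and> y < y2 R" and
      in_S: "x1 S < x \<and> x < x2 S \<and> y1 S < y \<and> y < y2 S" for R S x y
    proof (rule ccontr)
      assume "R \<noteq> S"
      then have "interior R \<inter> interior S = {}" using D(3) that(1,2) by (auto simp: pairwise_def)
      moreover have "x *\<^sub>R d + y *\<^sub>R e \<in> interior (frame_box d e (x1 R) (x2 R) (y1 R) (y2 R))"
        "x *\<^sub>R d + y *\<^sub>R e \<in> interior (frame_box d e (x1 S) (x2 S) (y1 S) (y2 S))"
        unfolding interior_frame_box[OF fr] mem_Collect_eq pt by (fact in_R, fact in_S)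
      ultimately show False using xy that(1,2) by (metis IntI empty_iff)
    qed
    show "x1 R \<le> x2 R \<and> y1 R \<le> y2 R" if "R \<in> \<D>" for R using xy[OF that] by simp
  qed (use assms(2,3) in auto)
  then have "F u u = (\<Sum>R\<in>\<D>. F (x2 R - x1 R) (y2 R - y1 R)) + F v v" by simp
  moreover have "(\<Sum>R\<in>\<D>. F (x2 R - x1 R) (y2 R - y1 R)) \<ge> 0"
    using xy by (intro sum_nonneg) blast
  \<comment> \<open>The mixed terms \<open>F u v\<close> and \<open>F v u\<close> cancel by
    symmetry.\<close>
  moreover have "F (u - v) (u + v) = F u u - F v v"
    using additive.diff[OF F(1)] additive.add[OF F(2)] sym by simp
  ultimately show ?thesis by simp
qed

section \<open>Functionals over a quadratic field\<close>

definition rat_linear :: "(real \<Rightarrow> real) \<Rightarrow> bool" where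
  "rat_linear g \<longleftrightarrow> Modules.additive g \<and> (\<forall>q\<in>\<rat>. \<forall>x. g (q * x) = q * g x)"

text \<open>A rational basis of \<open>S\<close> stays independent when \<open>w\<close> is added,
  so a functional can be prescribed on it. That its values are rational is needed later, to tell
  them apart from multiples of \<open>sqrt p\<close>.\<close>

lemma rat_linear_separating:
  fixes S :: "real set"
  assumes "0 \<in> S" "\<And>x y. x \<in> S \<Longrightarrow> y \<in> S \<Longrightarrow> x + y \<in> S"
    and "\<And>q x. q \<in> \<rat> \<Longrightarrow> x \<in> S \<Longrightarrow> q * x \<in> S" and "w \<notin> S"
  obtains g where "rat_linear g" "range g \<subseteq> \<rat>" "\<And>x. x \<in> S \<Longrightarrow> g x = 0" "g w = 1"
proof -
  \<comment> \<open>The reals form a vector space over the type \<open>rat\<close>; taking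
    \<open>rat\<close> itself as the target makes all values rational.\<close>
  interpret vector_space_pair "\<lambda>(q::rat) (x::real). of_rat q * x" "(*) :: rat \<Rightarrow> rat \<Rightarrow> rat"
    by unfold_locales (auto simp: algebra_simps of_rat_add of_rat_mult)
  have sub: "vs1.subspace S"
    using assms unfolding vs1.subspace_def by auto
  obtain B where B: "B \<subseteq> S" "vs1.independent B" "S \<subseteq> vs1.span B"
    using vs1.maximal_independent_subset by blast
  have "vs1.span B \<subseteq> S" using B(1) sub by (rule vs1.span_minimal)
  then have "w \<notin> vs1.span B" using assms(4) by blast
  with B(2) have "vs1.independent (insert w B)" by (rule vs1.independent_insertI[rotated])
  then obtain h where lin: "Vector_Spaces.linear (\<lambda>q x. of_rat q * x) (*) h"
    and h: "\<forall>x\<in>insert w B. h x = (if x = w then 1 else 0)"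
    using linear_independent_extend[where f = "\<lambda>x. if x = w then 1 else 0"] by blast
  have "w \<notin> B" using B(1) assms(4) by blast
  then have "h x = 0" if "x \<in> B" for x using h that by auto
  then have h0: "h x = 0" if "x \<in> S" for x
    using linear_eq_0_on_span[OF lin, of B x] B(3) that by blast
  show thesis
  proof (rule that[of "\<lambda>x. of_rat (h x)"])
    show "rat_linear (\<lambda>x. of_rat (h x))"
      unfolding rat_linear_def Modules.additive_def
    proof (intro conjI ballI allI)
      show "of_rat (h (x + y)) = of_rat (h x) + (of_rat (h y) :: real)" for x y
        using linear_add[OF lin] by (simp add: of_rat_add)
      show "of_rat (h (q * x)) = q * of_rat (h x)" if q: "q \<in> \<rat>" for q x :: real
      proof -
        obtain k where "q = of_rat k" using q by (rule Rats_cases)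
        then show ?thesis using linear_scale[OF lin, of k x] by (simp add: of_rat_mult)
      qed
    qed
  qed (use h0 h in auto)
qed

text \<open>\<open>k = \<plusminus> sqrt p\<close> gives the linear and the conjugate-linear functionals over the field generated by
  \<open>sqrt p\<close>.\<close>

definition sqrt_linear :: "real \<Rightarrow> real \<Rightarrow> (real \<Rightarrow> real) \<Rightarrow> bool" where
  "sqrt_linear p k \<Phi> \<longleftrightarrow> rat_linear \<Phi> \<and> (\<forall>x. \<Phi> (sqrt p * x) = k * \<Phi> x)"

lemma sqrt_linear_mult:
  assumes "sqrt_linear p k \<Phi>" "a \<in> \<rat>" "b \<in> \<rat>"
  shows "\<Phi> ((a + b * sqrt p) * x) = (a + b * k) * \<Phi> x"
proof -
  have "\<Phi> ((a + b * sqrt p) * x) = \<Phi> (a * x) + \<Phi> (b * (sqrt p * x))"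
    using assms unfolding sqrt_linear_def rat_linear_def
    by (simp add: Modules.additive_def distrib_right mult.assoc)
  then show ?thesis
    using assms unfolding sqrt_linear_def rat_linear_def by (simp add: algebra_simps)
qed

text \<open>Up to a factor this projects \<open>g\<close> to the eigenvalue \<open>k\<close> of the
  map induced by multiplication by \<open>sqrt p\<close>: that map exchanges the two summands up to
  \<open>k\<close>, because \<open>k * k = p\<close>.\<close>

lemma sqrt_linear_of_rat_linear:
  assumes "rat_linear g" "p \<in> \<rat>" "p > 0" "k\<^sup>2 = p"
  shows "sqrt_linear p k (\<lambda>x. g (sqrt p * x) + k * g x)"
proof -
  have add: "g (x + y) = g x + g y" and hom: "q \<in> \<rat> \<Longrightarrow> g (q * x) = q * g x" for x y q
    using assms(1) by (auto simp: rat_linear_def Modules.additive_def)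
  have "g (sqrt p * (sqrt p * x)) = k * (k * g x)" for x
  proof -
    have "sqrt p * (sqrt p * x) = p * x" using \<open>p > 0\<close> by (simp flip: mult.assoc)
    moreover have "p * g x = k * (k * g x)"
      unfolding assms(4)[symmetric] power2_eq_square by (rule mult.assoc)
    ultimately show ?thesis by (simp only: hom[OF assms(2)])
  qed
  moreover have "g (sqrt p * (x + y)) = g (sqrt p * x) + g (sqrt p * y)" for x y
    by (simp add: distrib_left add)
  moreover have "g (sqrt p * (q * x)) = q * g (sqrt p * x)" if "q \<in> \<rat>" for q x
    using hom[OF that, of "sqrt p * x"] by (simp add: mult.left_commute)
  ultimately show ?thesis
    unfolding sqrt_linear_def rat_linear_def Modules.additive_def
    by (simp add: add hom distrib_left mult.left_commute)
qed

lemma sqrt_linear_conjugate_exists: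
  assumes "p \<in> \<rat>" "p > 0" "sqrt p \<notin> \<rat>"
  obtains \<Phi> where "sqrt_linear p (- sqrt p) \<Phi>" "\<Phi> 1 = 1"
proof -
  \<comment> \<open>With \<open>g 1 = 0\<close> and \<open>g (sqrt p) = 1\<close>, the functional
    built from \<open>g\<close> takes the value 1 at 1.\<close>
  obtain g where g: "rat_linear g" "\<And>x. x \<in> \<rat> \<Longrightarrow> g x = 0" "g (sqrt p) = 1"
    by (rule rat_linear_separating[of "\<rat>" "sqrt p"]) (use assms(3) in auto)
  show thesis
    using that[OF sqrt_linear_of_rat_linear[OF g(1) assms(1,2), of "- sqrt p"]] g assms by simp
qed

text \<open>The functional \<Psi> built from a \<open>g\<close> that kills the field vanishes at 1
  but not at \<open>w\<close>. Subtracting a multiple of it from the identity keeps the value at 1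
  and moves the value at \<open>w\<close> to any desired number.\<close>

lemma sqrt_linear_separating:
  assumes "p \<in> \<rat>" "p > 0" "sqrt p \<notin> \<rat>"
    and w: "w \<notin> {x + y * sqrt p | x y. x \<in> \<rat> \<and> y \<in> \<rat>}" (is "_ \<notin> ?K")
  obtains \<Phi> where "sqrt_linear p (sqrt p) \<Phi>" "\<Phi> 1 = 1" "\<Phi> w = - 1"
proof -
  have K0: "0 \<in> ?K" by (auto intro!: exI[of _ 0])
  have K_add: "x + y \<in> ?K" if xy: "x \<in> ?K" "y \<in> ?K" for x y
  proof -
    obtain x1 x2 y1 y2 where "x = x1 + x2 * sqrt p" "y = y1 + y2 * sqrt p"
      "x1 \<in> \<rat>" "x2 \<in> \<rat>" "y1 \<in> \<rat>" "y2 \<in> \<rat>" using xy by auto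
    then show ?thesis
      unfolding mem_Collect_eq by (intro exI[of _ "x1 + y1"] exI[of _ "x2 + y2"]) (auto simp: algebra_simps)
  qed
  have K_mult: "q * x \<in> ?K" if q: "q \<in> \<rat>" and x: "x \<in> ?K" for q x
  proof -
    obtain x1 x2 where "x = x1 + x2 * sqrt p" "x1 \<in> \<rat>" "x2 \<in> \<rat>" using x by auto
    then show ?thesis using q
      unfolding mem_Collect_eq by (intro exI[of _ "q * x1"] exI[of _ "q * x2"]) (auto simp: algebra_simps)
  qed
  obtain g where g: "rat_linear g" "range g \<subseteq> \<rat>" "\<And>x. x \<in> ?K \<Longrightarrow> g x = 0" "g w = 1"
    using rat_linear_separating[OF K0 K_add K_mult w] by blast
  define \<Psi> where "\<Psi> x = g (sqrt p * x) + sqrt p * g x" for x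
  have \<Psi>: "sqrt_linear p (sqrt p) \<Psi>"
    unfolding \<Psi>_def using g(1) assms by (intro sqrt_linear_of_rat_linear) auto
  have "1 \<in> ?K"
    unfolding mem_Collect_eq by (intro exI[of _ 1] exI[of _ 0]) simp
  moreover have "sqrt p \<in> ?K"
    unfolding mem_Collect_eq by (intro exI[of _ 0] exI[of _ 1]) simp
  ultimately have \<Psi>1: "\<Psi> 1 = 0" using g(3) by (simp add: \<Psi>_def)
  \<comment> \<open>\<Psi> takes the value \<open>g (sqrt p * w) + sqrt p\<close> at
    \<open>w\<close>, a rational plus an irrational number.\<close>
  have \<Psi>w: "\<Psi> w \<noteq> 0"
  proof
    assume "\<Psi> w = 0"
    then have "sqrt p = - g (sqrt p * w)" using g(4) by (simp add: \<Psi>_def)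
    moreover have "g (sqrt p * w) \<in> \<rat>" using g(2) by blast
    ultimately have "sqrt p \<in> \<rat>" by (metis Rats_minus_iff)
    with assms(3) show False by simp
  qed
  define C where "C = (w + 1) / \<Psi> w"
  show thesis
  proof (rule that[of "\<lambda>x. x - C * \<Psi> x"])
    show "sqrt_linear p (sqrt p) (\<lambda>x. x - C * \<Psi> x)"
    proof -
      have "\<Psi> (x + y) = \<Psi> x + \<Psi> y" "q \<in> \<rat> \<Longrightarrow> \<Psi> (q * x) = q * \<Psi> x"
        "\<Psi> (sqrt p * x) = sqrt p * \<Psi> x" for x y q
        using \<Psi> by (auto simp: sqrt_linear_def rat_linear_def Modules.additive_def)
      then show ?thesis
        unfolding sqrt_linear_def rat_linear_def Modules.additive_def
        by (simp add: algebra_simps)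
    qed
    show "1 - C * \<Psi> 1 = 1" "w - C * \<Psi> w = - 1"
      using \<Psi>1 \<Psi>w by (simp_all add: C_def)
  qed
qed

section \<open>The two cones\<close>

lemma ratio_mem_field:
  fixes u v :: real
  assumes "a \<in> \<rat>" "b \<in> \<rat>" "p \<in> \<rat>" "p > 0" "sqrt p \<notin> \<rat>" "a + b * sqrt p > 0"
    and "u > v" "v > 0" "orthonormal_frame d e"
    and dis: "dissectible_into_ratio (square_with_hole c d e u v) (a + b * sqrt p)"
  shows "(u + v) / (u - v) \<in> {x + y * sqrt p | x y. x \<in> \<rat> \<and> y \<in> \<rat>}"
proof (rule ccontr)
  let ?x = "(u + v) / (u - v)"
  assume "\<not> ?thesis"
  then obtain \<Phi> where \<Phi>: "sqrt_linear p (sqrt p) \<Phi>" "\<Phi> 1 = 1" "\<Phi> ?x = - 1"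
    using sqrt_linear_separating[OF assms(3-5), of ?x] by blast
  \<comment> \<open>On a tile this is \<open>r\<close> times a square, yet on \<open>u - v\<close>
    and \<open>u + v\<close> it is the product of the values of \<Phi> at 1 and at the ratio, which
    is negative.\<close>
  define F where "F y z = \<Phi> (y / (u - v)) * \<Phi> (z / (u - v))" for y z
  have add: "\<Phi> (x + y) = \<Phi> x + \<Phi> y" for x y
    using \<Phi>(1) by (auto simp: sqrt_linear_def rat_linear_def Modules.additive_def)
  have "F (u - v) (u + v) \<ge> 0"
  proof (rule biadditive_nonneg_of_dissectible[OF assms(9,7,8,6) dis])
    show "F s ((a + b * sqrt p) * s) \<ge> 0" for s
    proof -
      have "F s ((a + b * sqrt p) * s) = (a + b * sqrt p) * (\<Phi> (s / (u - v)))\<^sup>2"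
        using sqrt_linear_mult[OF \<Phi>(1) assms(1,2), of "s / (u - v)"]
        by (simp add: F_def power2_eq_square)
      then show ?thesis using assms(6) by simp
    qed
  qed (auto simp: F_def Modules.additive_def add_divide_distrib add algebra_simps)
  moreover have "F (u - v) (u + v) = - 1"
    using \<Phi>(2,3) \<open>u > v\<close> by (simp add: F_def)
  ultimately show False by simp
qed

text \<open>The three coefficients describe a symmetric form in the identity \<open>f\<close> and
  the conjugate-linear \<open>g\<close>, both scaled to be 1 at \<open>u - v\<close>. The hypothesis
  \<open>form\<close> is nonnegativity on tiles with \<open>f s\<close> and \<open>g s\<close>
  replaced by arbitrary reals; the conclusion is the value at \<open>u - v\<close> and
  \<open>u + v\<close>.\<close>

lemma ratio_form_nonneg:
  fixes u v :: real
  assumes "a \<in> \<rat>" "b \<in> \<rat>" "p \<in> \<rat>" "p > 0" "sqrt p \<notin> \<rat>" "a + b * sqrt p > 0"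
    and "u > v" "v > 0" "orthonormal_frame d e"
    and dis: "dissectible_into_ratio (square_with_hole c d e u v) (a + b * sqrt p)"
    and x: "(u + v) / (u - v) = x + y * sqrt p" "x \<in> \<rat>" "y \<in> \<rat>"
    and form: "\<And>s t. c1 * (a + b * sqrt p) * s\<^sup>2 + c2 * (a - b * sqrt p) * t\<^sup>2 + 2 * a * c3 * s * t \<ge> 0"
  shows "(c1 + c2 + 2 * c3) * x + (c1 - c2) * (y * sqrt p) \<ge> 0"
proof -
  obtain \<Psi> where \<Psi>: "sqrt_linear p (- sqrt p) \<Psi>" "\<Psi> 1 = 1"
    using sqrt_linear_conjugate_exists[OF assms(3-5)] by blast
  define f where "f z = z / (u - v)" for z
  define g where "g z = \<Psi> (z / (u - v))" for z
  define F where "F y z = c1 * (f y * f z) + c2 * (g y * g z) + c3 * (f y * g z + g y * f z)" for y z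
  have "\<Psi> (x + y) = \<Psi> x + \<Psi> y" for x y
    using \<Psi>(1) by (auto simp: sqrt_linear_def rat_linear_def Modules.additive_def)
  then have add: "f (y + z) = f y + f z" "g (y + z) = g y + g z" for y z
    by (simp_all add: f_def g_def add_divide_distrib)
  have "F (u - v) (u + v) \<ge> 0"
  proof (rule biadditive_nonneg_of_dissectible[OF assms(9,7,8,6) dis])
    show "F s ((a + b * sqrt p) * s) \<ge> 0" for s
    proof -
      have hom: "f ((a + b * sqrt p) * s) = (a + b * sqrt p) * f s"
        "g ((a + b * sqrt p) * s) = (a - b * sqrt p) * g s"
        using sqrt_linear_mult[OF \<Psi>(1) assms(1,2), of "s / (u - v)"]
        by (simp_all add: f_def g_def)
      have "F s ((a + b * sqrt p) * s) =
        c1 * (a + b * sqrt p) * (f s)\<^sup>2 + c2 * (a - b * sqrt p) * (g s)\<^sup>2 + 2 * a * c3 * f s * g s"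
        unfolding F_def hom by (simp add: power2_eq_square algebra_simps)
      then show ?thesis using form by simp
    qed
    show "F y z = F z y" for y z by (simp add: F_def algebra_simps)
    show "Modules.additive (F y)" "Modules.additive (\<lambda>y. F y z)" for y z
      unfolding Modules.additive_def F_def by (simp_all add: add algebra_simps)
  qed
  moreover have "f (u - v) = 1" "g (u - v) = 1" "f (u + v) = x + y * sqrt p" "g (u + v) = x - y * sqrt p"
    using \<open>u > v\<close> \<Psi>(2) x sqrt_linear_mult[OF \<Psi>(1) x(2,3), of 1] by (simp_all add: f_def g_def)
  ultimately show ?thesis by (simp add: F_def algebra_simps)
qed

text \<open>Here \<open>B\<close> and \<open>y\<close> stand for the irrational parts of
  \<open>r\<close> and of the ratio, including the factor \<open>sqrt p\<close>. Nonnegative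
  multiples of squares are inserted into \<open>form\<close>, chosen so that the conclusions are the
  two sides of the bound.\<close>

lemma cone_bound_pos:
  fixes a B x y :: real
  assumes "a + B > 0" "a - B > 0" "x + y > 0"
    and form: "\<And>c1 c2 c3. (\<And>s t. c1 * (a + B) * s\<^sup>2 + c2 * (a - B) * t\<^sup>2 + 2 * a * c3 * s * t \<ge> 0) \<Longrightarrow>
      (c1 + c2 + 2 * c3) * x + (c1 - c2) * y \<ge> 0"
  shows "x > 0 \<and> a * \<bar>y\<bar> \<le> \<bar>B\<bar> * x"
proof -
  have "a > 0" using assms(1,2) by linarith
  have x0: "x \<ge> 0" using form[of 1 1 0] assms(1,2) by simp
  have bound: "a * \<bar>y\<bar> \<le> \<bar>B\<bar> * x"
  proof (cases "B = 0")
    case False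
    \<comment> \<open>The form is \<open>a\<close> times the square of
      \<open>(a + B) * s - (a - B) * t\<close>.\<close>
    have "(a * (a + B) + a * (a - B) + 2 * ((a + B) * (B - a))) * x + (a * (a + B) - a * (a - B)) * y \<ge> 0"
    proof (rule form)
      fix s t
      have "a * ((a + B) * s - (a - B) * t)\<^sup>2 \<ge> 0" using \<open>a > 0\<close> by simp
      then show "a * (a + B) * (a + B) * s\<^sup>2 + a * (a - B) * (a - B) * t\<^sup>2
          + 2 * a * ((a + B) * (B - a)) * s * t \<ge> 0"
        by (simp add: power2_eq_square algebra_simps)
    qed
    then have "0 \<le> 2 * B * (B * x + a * y)" by (simp add: algebra_simps)
    \<comment> \<open>Exchanging the outer coefficients gives a positive multiple of the square of
      \<open>s - t\<close> and the opposite sign of \<open>y\<close>.\<close>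
    moreover have "(a * (a - B) + a * (a + B) + 2 * ((a + B) * (B - a))) * x + (a * (a - B) - a * (a + B)) * y \<ge> 0"
    proof (rule form)
      fix s t
      have "a * (a + B) * (a - B) * (s - t)\<^sup>2 \<ge> 0" using \<open>a > 0\<close> assms(1,2) by simp
      then show "a * (a - B) * (a + B) * s\<^sup>2 + a * (a + B) * (a - B) * t\<^sup>2
          + 2 * a * ((a + B) * (B - a)) * s * t \<ge> 0"
        by (simp add: power2_eq_square algebra_simps)
    qed
    then have "0 \<le> 2 * B * (B * x - a * y)" by (simp add: algebra_simps)
    ultimately have "\<bar>B * (a * y)\<bar> \<le> B * B * x" by (simp add: abs_le_iff algebra_simps)
    also have "\<bar>B * (a * y)\<bar> = \<bar>B\<bar> * (a * \<bar>y\<bar>)" using \<open>a > 0\<close> by (simp add: abs_mult)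
    also have "B * B * x = \<bar>B\<bar> * (\<bar>B\<bar> * x)" by (simp flip: mult.assoc)
    finally show ?thesis using False by (simp add: mult_le_cancel_left_pos)
  next
    case True
    \<comment> \<open>For \<open>B = 0\<close> one must show \<open>y = 0\<close>. The square of
      \<open>s - (1 - k) * t\<close> yields an inequality whose part linear in \<open>k\<close> is
      \<open>2 * k * y\<close>; this \<open>k\<close> has the opposite sign to \<open>y\<close> and
      is small enough for that part to win unless \<open>k = 0\<close>.\<close>
    define n where "n = \<bar>x - y\<bar> + 1"
    define k where "k = - y / n"
    have n: "n > 0" "x - y \<le> n" by (auto simp: n_def)
    have "(1 + (1 - k)\<^sup>2 + 2 * (k - 1)) * x + (1 - (1 - k)\<^sup>2) * y \<ge> 0"
    proof (rule form)
      fix s t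
      have "a * (s - (1 - k) * t)\<^sup>2 \<ge> 0" using \<open>a > 0\<close> by simp
      then show "1 * (a + B) * s\<^sup>2 + (1 - k)\<^sup>2 * (a - B) * t\<^sup>2 + 2 * a * (k - 1) * s * t \<ge> 0"
        by (simp add: True power2_eq_square algebra_simps)
    qed
    then have "k\<^sup>2 * (x - y) + 2 * k * y \<ge> 0" by (simp add: power2_eq_square algebra_simps)
    moreover have "k\<^sup>2 * (x - y) \<le> k\<^sup>2 * n" using n(2) by (rule mult_left_mono) simp
    moreover have "y = - k * n" using n(1) by (simp add: k_def)
    ultimately have "k\<^sup>2 * n \<le> 0" by (simp add: power2_eq_square algebra_simps)
    then have "k = 0" using n(1) by (simp add: mult_le_0_iff)
    then show ?thesis using \<open>y = - k * n\<close> True by simp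
  qed
  moreover have "x \<noteq> 0"
    using bound \<open>x + y > 0\<close> \<open>a > 0\<close> by (auto simp: mult_le_0_iff)
  ultimately show ?thesis using x0 by simp
qed

text \<open>As in \<open>cone_bound_pos\<close>, with \<open>B\<close> positive and \<open>a\<close>
  of any sign. Now \<open>a - B\<close> is negative, so the coefficient \<open>c2\<close> has to be
  negative for the form to be nonnegative.\<close>

lemma cone_bound_neg:
  fixes a B x y :: real
  assumes "a + B > 0" "a - B < 0" "x + y > 0"
    and form: "\<And>c1 c2 c3. (\<And>s t. c1 * (a + B) * s\<^sup>2 + c2 * (a - B) * t\<^sup>2 + 2 * a * c3 * s * t \<ge> 0) \<Longrightarrow>
      (c1 + c2 + 2 * c3) * x + (c1 - c2) * y \<ge> 0"
  shows "y > 0 \<and> B * \<bar>x\<bar> \<le> \<bar>a\<bar> * y"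
proof -
  have "B > 0" using assms(1,2) by linarith
  have y0: "y \<ge> 0" using form[of 1 "- 1" 0] assms(1,2) by simp
  have bound: "B * \<bar>x\<bar> \<le> \<bar>a\<bar> * y"
  proof (cases "a = 0")
    case False
    \<comment> \<open>The mixed term carries the factor \<open>a\<close>, so \<open>a\<close> is
      divided out to complete the squares of \<open>(a + B) * s - (a - B) * t\<close> and of
      \<open>s - t\<close>.\<close>
    define k where "k = B * (a + B) * (a - B) / a"
    have k: "a * k = B * (a + B) * (a - B)" using False by (simp add: k_def)
    have "(B * (a + B) + B * (a - B) + 2 * (- k)) * x + (B * (a + B) - B * (a - B)) * y \<ge> 0"
    proof (rule form)
      fix s t
      have "0 \<le> B * ((a + B) * s - (a - B) * t)\<^sup>2" using \<open>B > 0\<close> by simp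
      also have "\<dots> = B * (a + B) * (a + B) * s\<^sup>2 + B * (a - B) * (a - B) * t\<^sup>2
          - 2 * (B * (a + B) * (a - B)) * s * t"
        by (simp add: power2_eq_square algebra_simps)
      finally show "B * (a + B) * (a + B) * s\<^sup>2 + B * (a - B) * (a - B) * t\<^sup>2
          + 2 * a * (- k) * s * t \<ge> 0"
        unfolding k[symmetric] by (simp add: algebra_simps)
    qed
    then have form1: "(2 * a * B - 2 * k) * x + 2 * B\<^sup>2 * y \<ge> 0"
      by (simp add: power2_eq_square algebra_simps)
    have k1: "2 * a * B - 2 * k = 2 * B\<^sup>2 * (B / a)"
      using False by (simp add: k_def field_simps power2_eq_square)
    have "0 \<le> 2 * B\<^sup>2 * (B / a * x + y)"
      using form1 unfolding k1 by (simp only: algebra_simps)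
    then have 1: "0 \<le> B / a * x + y" using \<open>B > 0\<close> by (simp add: zero_le_mult_iff)
    have "(B * (B - a) + - B * (a + B) + 2 * k) * x + (B * (B - a) - - B * (a + B)) * y \<ge> 0"
    proof (rule form)
      fix s t
      have "0 \<le> B * (a + B) * (B - a) * (s - t)\<^sup>2" using \<open>B > 0\<close> assms(1,2) by simp
      also have "\<dots> = B * (B - a) * (a + B) * s\<^sup>2 + - B * (a + B) * (a - B) * t\<^sup>2
          + 2 * (B * (a + B) * (a - B)) * s * t"
        by (simp add: power2_eq_square algebra_simps)
      finally show "B * (B - a) * (a + B) * s\<^sup>2 + - B * (a + B) * (a - B) * t\<^sup>2
          + 2 * a * k * s * t \<ge> 0"
        unfolding k[symmetric] by (simp add: algebra_simps)
    qed
    then have form2: "(- 2 * a * B + 2 * k) * x + 2 * B\<^sup>2 * y \<ge> 0"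
      by (simp add: power2_eq_square algebra_simps)
    have k2: "- 2 * a * B + 2 * k = - 2 * B\<^sup>2 * (B / a)"
      using False by (simp add: k_def field_simps power2_eq_square)
    have "0 \<le> 2 * B\<^sup>2 * (y - B / a * x)"
      using form2 unfolding k2 by (simp only: algebra_simps)
    then have "0 \<le> y - B / a * x" using \<open>B > 0\<close> by (simp add: zero_le_mult_iff)
    with 1 have "\<bar>B / a * x\<bar> \<le> y" by (simp add: abs_le_iff)
    then show ?thesis using False \<open>B > 0\<close> by (simp add: abs_mult field_simps)
  next
    case True
    have "x = 0"
    proof (rule ccontr)
      assume "x \<noteq> 0"
      \<comment> \<open>For \<open>a = 0\<close> the mixed term vanishes and its coefficient is
        free; this choice makes the conclusion equal to -2.\<close>
      define k where "k = - (y + 1) / x"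
      have "(1 + - 1 + 2 * k) * x + (1 - - 1) * y \<ge> 0"
        using \<open>B > 0\<close> by (intro form) (simp add: True)
      then show False using \<open>x \<noteq> 0\<close> by (simp add: k_def)
    qed
    then show ?thesis using True by simp
  qed
  moreover have "y \<noteq> 0"
    using bound \<open>x + y > 0\<close> \<open>B > 0\<close> by (auto simp: mult_le_0_iff)
  ultimately show ?thesis using y0 by simp
qed

section \<open>Tileability of the ratios in the cones\<close>

text \<open>The conjugate is the positive rational norm divided by \<open>r\<close>, hence tileable.
  The target is the combination of \<open>r\<close> and its conjugate with weights
  \<open>(x / a + y / b) / 2\<close> and \<open>(x / a - y / b) / 2\<close>, and the cone condition
  makes these nonnegative.\<close>

lemma tileable_ratio_cone_pos:
  assumes "a \<in> \<rat>" "b \<in> \<rat>" "p \<in> \<rat>" "p > 0" "a + b * sqrt p > 0" "a - b * sqrt p > 0"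
    and "x \<in> \<rat>" "y \<in> \<rat>" "x > 0" "\<bar>y\<bar> / x \<le> \<bar>b\<bar> / a"
  shows "tileable_ratio (a + b * sqrt p) (x + y * sqrt p)"
proof -
  let ?r = "a + b * sqrt p" and ?r' = "a - b * sqrt p"
  have "a > 0" using assms(5,6) by linarith
  have norm: "?r * ?r' = a\<^sup>2 - b\<^sup>2 * p"
    using \<open>p > 0\<close> by (simp add: power2_eq_square algebra_simps)
  have "a\<^sup>2 - b\<^sup>2 * p > 0" unfolding norm[symmetric] using assms(5,6) by simp
  then have "tileable_ratio ?r ((a\<^sup>2 - b\<^sup>2 * p) * (1 / ?r))"
    using assms by (intro tileable_ratio_rat_mult tileable_ratio_inverse tileable_ratio_self) auto
  then have conj: "tileable_ratio ?r ?r'"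
    unfolding norm[symmetric] using assms(5) by simp
  \<comment> \<open>If \<open>b = 0\<close>, the cone condition forces \<open>y = 0\<close>, and
    division by zero gives the required value 0.\<close>
  have yb: "y / b * b = y" "\<bar>y / b\<bar> \<le> x / a"
    using assms(9,10) \<open>a > 0\<close>
    by (cases "b = 0"; auto simp: divide_le_0_iff; simp add: field_simps)+
  have weights: "x / a + y / b \<ge> 0" "x / a - y / b \<ge> 0" "x / a > 0"
    using yb(2) assms(9) \<open>a > 0\<close> by (simp_all only: abs_le_iff, linarith, linarith, simp)
  then have "x / a + y / b > 0 \<or> x / a - y / b > 0" by linarith
  with weights have "tileable_ratio ?r ((x / a + y / b) / 2 * ?r + (x / a - y / b) / 2 * ?r')"
    using assms conj
    by (intro tileable_ratio_rat_combination tileable_ratio_self) auto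
  also have "(x / a + y / b) / 2 * ?r + (x / a - y / b) / 2 * ?r' = x / a * a + y / b * b * sqrt p"
  proof -
    have "(k + l) / 2 * (A + B) + (k - l) / 2 * (A - B) = k * A + l * B" for k l A B :: real
      by (simp add: field_simps)
    then show ?thesis by (simp only: mult.assoc)
  qed
  also have "\<dots> = x + y * sqrt p" using yb(1) \<open>a > 0\<close> by simp
  finally show ?thesis .
qed

text \<open>The same argument with the negated conjugate, which is now the positive one; the
  coordinates exchange their roles.\<close>

lemma tileable_ratio_cone_neg:
  assumes "a \<in> \<rat>" "b \<in> \<rat>" "p \<in> \<rat>" "p > 0" "a + b * sqrt p > 0" "a - b * sqrt p < 0"
    and "x \<in> \<rat>" "y \<in> \<rat>" "y > 0" "\<bar>x\<bar> / y \<le> \<bar>a\<bar> / b"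
  shows "tileable_ratio (a + b * sqrt p) (x + y * sqrt p)"
proof -
  let ?r = "a + b * sqrt p" and ?r' = "b * sqrt p - a"
  have "b * sqrt p > 0" using assms(5,6) by linarith
  then have "b > 0" using \<open>p > 0\<close> by (simp add: zero_less_mult_iff)
  have norm: "?r * ?r' = b\<^sup>2 * p - a\<^sup>2"
    using \<open>p > 0\<close> by (simp add: power2_eq_square algebra_simps)
  have "b\<^sup>2 * p - a\<^sup>2 > 0" unfolding norm[symmetric] using assms(5,6) by simp
  then have "tileable_ratio ?r ((b\<^sup>2 * p - a\<^sup>2) * (1 / ?r))"
    using assms by (intro tileable_ratio_rat_mult tileable_ratio_inverse tileable_ratio_self) auto
  then have conj: "tileable_ratio ?r ?r'"
    unfolding norm[symmetric] using assms(5) by simp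
  have xa: "x / a * a = x" "\<bar>x / a\<bar> \<le> y / b"
    using assms(9,10) \<open>b > 0\<close>
    by (cases "a = 0"; auto simp: divide_le_0_iff; simp add: field_simps)+
  have weights: "y / b + x / a \<ge> 0" "y / b - x / a \<ge> 0" "y / b > 0"
    using xa(2) assms(9) \<open>b > 0\<close> by (simp_all only: abs_le_iff, linarith, linarith, simp)
  then have "y / b + x / a > 0 \<or> y / b - x / a > 0" by linarith
  with weights have "tileable_ratio ?r ((y / b + x / a) / 2 * ?r + (y / b - x / a) / 2 * ?r')"
    using assms conj
    by (intro tileable_ratio_rat_combination tileable_ratio_self) auto
  also have "(y / b + x / a) / 2 * ?r + (y / b - x / a) / 2 * ?r' = x / a * a + y / b * b * sqrt p"
  proof -
    have "(k + l) / 2 * (A + B) + (k - l) / 2 * (B - A) = l * A + k * B" for k l A B :: real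
      by (simp add: field_simps)
    then show ?thesis by (simp only: mult.assoc)
  qed
  also have "\<dots> = x + y * sqrt p" using xa(1) \<open>b > 0\<close> by simp
  finally show ?thesis .
qed

theorem mainTheorem3:
  fixes a b p u v :: real and c d e :: "real^2" and M :: "(real^2) set"
  assumes "a \<in> \<rat>" "b \<in> \<rat>" "p \<in> \<rat>"
    and "p > 0" "sqrt p \<notin> \<rat>" "a + b * sqrt p > 0"
    and "u > v" "v > 0"
    and "orthonormal_frame d e"
    and "M = square_with_hole c d e u v"
  shows "(a - b * sqrt p > 0 \<longrightarrow>
            (dissectible_into_ratio M (a + b * sqrt p) \<longleftrightarrow>
             (u + v) / (u - v) \<in>
               {x + y * sqrt p | x y. x \<in> \<rat> \<and> y \<in> \<rat> \<and> x > 0 \<and> \<bar>y\<bar> / x \<le> \<bar>b\<bar> / a})) \<and>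
         (a - b * sqrt p < 0 \<longrightarrow>
            (dissectible_into_ratio M (a + b * sqrt p) \<longleftrightarrow>
             (u + v) / (u - v) \<in>
               {x + y * sqrt p | x y. x \<in> \<rat> \<and> y \<in> \<rat> \<and> y > 0 \<and> \<bar>x\<bar> / y \<le> \<bar>a\<bar> / b}))"
proof (intro conjI impI)
  let ?r = "a + b * sqrt p" and ?r' = "a - b * sqrt p" and ?x = "(u + v) / (u - v)"
  have "?x > 0" using assms(7,8) by simp
  \<comment> \<open>Both cases share this: the ratio lies in the field, and its coordinates satisfy
    the inequality of every form nonnegative on tiles.\<close>
  have necessary: "\<exists>x y. ?x = x + y * sqrt p \<and> x \<in> \<rat> \<and> y \<in> \<rat> \<and>
      (\<forall>c1 c2 c3. (\<forall>s t. c1 * ?r * s\<^sup>2 + c2 * ?r' * t\<^sup>2 + 2 * a * c3 * s * t \<ge> 0) \<longrightarrow>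
        (c1 + c2 + 2 * c3) * x + (c1 - c2) * (y * sqrt p) \<ge> 0)"
    if dis: "dissectible_into_ratio M ?r"
  proof -
    note dis' = dis[unfolded assms(10)]
    obtain x y where xy: "?x = x + y * sqrt p" "x \<in> \<rat>" "y \<in> \<rat>"
      using ratio_mem_field[OF assms(1-9) dis'] by blast
    then show ?thesis using ratio_form_nonneg[OF assms(1-9) dis' xy] by blast
  qed
  {
    assume pos: "?r' > 0"
    show "dissectible_into_ratio M ?r \<longleftrightarrow> ?x \<in>
      {x + y * sqrt p | x y. x \<in> \<rat> \<and> y \<in> \<rat> \<and> x > 0 \<and> \<bar>y\<bar> / x \<le> \<bar>b\<bar> / a}" (is "_ \<longleftrightarrow> _ \<in> ?S")
    proof
      assume "dissectible_into_ratio M ?r"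
      from necessary[OF this] obtain x y where xy: "?x = x + y * sqrt p" "x \<in> \<rat>" "y \<in> \<rat>"
        and form: "\<And>c1 c2 c3. (\<And>s t. c1 * ?r * s\<^sup>2 + c2 * ?r' * t\<^sup>2 + 2 * a * c3 * s * t \<ge> 0) \<Longrightarrow>
          (c1 + c2 + 2 * c3) * x + (c1 - c2) * (y * sqrt p) \<ge> 0"
        by blast
      \<comment> \<open>The cone bound is applied to the irrational parts; the common factor
        \<open>sqrt p\<close> is cancelled afterwards.\<close>
      have "x > 0 \<and> a * \<bar>y * sqrt p\<bar> \<le> \<bar>b * sqrt p\<bar> * x"
        using cone_bound_pos[OF assms(6) pos _ form] xy(1) \<open>?x > 0\<close> by simp
      then have "x > 0" "(a * \<bar>y\<bar>) * sqrt p \<le> (\<bar>b\<bar> * x) * sqrt p"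
        using \<open>p > 0\<close> by (auto simp: abs_mult algebra_simps)
      moreover have "a > 0" using assms(6) pos by linarith
      ultimately have "\<bar>y\<bar> / x \<le> \<bar>b\<bar> / a"
        using \<open>p > 0\<close> by (simp add: field_simps)
      then show "?x \<in> ?S" using xy \<open>x > 0\<close> by blast
    next
      assume "?x \<in> ?S"
      then have "tileable_ratio ?r ?x"
        using tileable_ratio_cone_pos[OF assms(1-4,6) pos] by auto
      then show "dissectible_into_ratio M ?r"
        unfolding assms(10) by (rule dissectible_square_with_hole[OF assms(9,7,8)])
    qed
  next
    assume neg: "?r' < 0"
    show "dissectible_into_ratio M ?r \<longleftrightarrow> ?x \<in>
      {x + y * sqrt p | x y. x \<in> \<rat> \<and> y \<in> \<rat> \<and> y > 0 \<and> \<bar>x\<bar> / y \<le> \<bar>a\<bar> / b}" (is "_ \<longleftrightarrow> _ \<in> ?S")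
    proof
      assume "dissectible_into_ratio M ?r"
      from necessary[OF this] obtain x y where xy: "?x = x + y * sqrt p" "x \<in> \<rat>" "y \<in> \<rat>"
        and form: "\<And>c1 c2 c3. (\<And>s t. c1 * ?r * s\<^sup>2 + c2 * ?r' * t\<^sup>2 + 2 * a * c3 * s * t \<ge> 0) \<Longrightarrow>
          (c1 + c2 + 2 * c3) * x + (c1 - c2) * (y * sqrt p) \<ge> 0"
        by blast
      have "y * sqrt p > 0 \<and> b * sqrt p * \<bar>x\<bar> \<le> \<bar>a\<bar> * (y * sqrt p)"
        using cone_bound_neg[OF assms(6) neg _ form] xy(1) \<open>?x > 0\<close> by simp
      then have "y > 0" "(b * \<bar>x\<bar>) * sqrt p \<le> (\<bar>a\<bar> * y) * sqrt p"
        using \<open>p > 0\<close> by (auto simp: zero_less_mult_iff algebra_simps)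
      moreover have "b * sqrt p > 0" using assms(6) neg by linarith
      then have "b > 0" using \<open>p > 0\<close> by (simp add: zero_less_mult_iff)
      ultimately have "\<bar>x\<bar> / y \<le> \<bar>a\<bar> / b"
        using \<open>p > 0\<close> by (simp add: field_simps)
      then show "?x \<in> ?S" using xy \<open>y > 0\<close> by blast
    next
      assume "?x \<in> ?S"
      then have "tileable_ratio ?r ?x"
        using tileable_ratio_cone_neg[OF assms(1-4,6) neg] by auto
      then show "dissectible_into_ratio M ?r"
        unfolding assms(10) by (rule dissectible_square_with_hole[OF assms(9,7,8)])
    qed
  }
qed

end
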